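(* Let $0<\lambda<1$, $0\le k<1$ and let $N\ge 1$ be an integer. Then $$F(\lambda,k)=\frac12\ln\frac{1+\lambda}{1-\lambda}\sum_{j=0}^{N}\frac{(1/2)_j(1/2)_j}{(j!)^2}(1-k^2)^j+\frac{1}{2\lambda}\sum_{n=0}^{N-1}\left(\frac{1-\lambda^2}{-\lambda^2}\right)^{n}s_n\!\left(\frac{(1-k^2)\lambda^2}{1-\lambda^2}\right)+R_N(\lambda,k),$$ where the remainder $R_N(\lambda,k)$ (defined by this equality) is negative and satisfies $$\frac{[(1/2)_{N+1}]^2(1-k^2)^N}{2[(N+1)!]^2}\,f_{N+1}(\lambda,k)\le -R_N(\lambda,k)\le\frac{[(1/2)_{N+1}]^2(1-k^2)^N}{2[(N+1)!]^2}\,f_N(\lambda,k).$$ Here, with $\alpha=\alpha_N=\frac{(N+1/2)^2}{(N+1)^2}$, $$f_N(\lambda,k)=\frac{1}{1-\alpha(1-k^2)}\left\{\frac{1}{\alpha\lambda\sqrt{1+\frac{1-\lambda^2}{\alpha\lambda^2(1-k^2)}}}\ln\frac{\sqrt{1+\frac{1-\lambda^2}{\alpha\lambda^2(1-k^2)}}+1}{\sqrt{1+\frac{1-\lambda^2}{\alpha\lambda^2(1-k^2)}}-1}-(1-k^2)\ln\frac{1+\lambda}{1-\lambda}\right\}.$$ Moreover, $f_N$ is positive; for each $N$ it is bounded on every set $E\subset(0,1)\times[0,1)$ of points $(\lambda,k)$ for which $\sup_{(\lambda,k)\in E}\frac{1-k}{1-\lambda}<\infty$; and for fixed $(\lambda,k)$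 it is monotone decreasing in $N$.
   Context: Legendre's incomplete elliptic integral of the first kind is $F(\lambda,k)=\int_0^\lambda\frac{dt}{\sqrt{(1-t^2)(1-k^2t^2)}}$. The Pochhammer symbol is $(a)_0=1$, $(a)_n=a(a+1)\cdots(a+n-1)$. The functions $s_n(x)$, $x\ge 0$, $n=0,1,2,\dots$, are the elementary functions determined by the starting values $$s_0(x)=-2\ln\frac{1+\sqrt{1+x}}{2},$$ $$s_1(x)=\left(\frac{x}{2}-1\right)\ln\frac{1+\sqrt{1+x}}{2}-\frac12\sqrt{1+x}+\frac12+\frac{x}{2},$$ $$s_2(x)=\left(-\frac{9}{32}x^2+\frac{x}{4}-\frac34\right)\ln\frac{1+\sqrt{1+x}}{2}+\left(\frac{9}{32}x-\frac{7}{16}\right)\sqrt{1+x}+\frac{7}{16}+\frac18x-\frac{21}{64}x^2,$$ and the recurrence, for $n\ge0$, $$4(n+3)^2s_{n+3}(x)=a_n(x)s_{n+2}(x)+b_n(x)s_{n+1}(x)+c_n(x)s_n(x)+h_n(x),$$ where $a_n(x)=8n^2+36n+42-x(2n+5)^2$, $b_n(x)=2x(4n^2+14n+13)-(2n+3)^2$, $c_n(x)=-4x(n+1)^2$, and $$h_n(x)=\frac{x(2n+5)(2n+3)^2+(n+3)(8n^2+24n+17)}{8(n+3)[(n+2)!]^2}\,[(3/2)_n]^2(-x)^{n+2}.$$ *)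

theory Defs
  imports "HOL-Analysis.Analysis"
begin

text \<open>For \<open>0 \<le> l < 1\<close> and \<open>0 \<le> k < 1\<close> the integrand is continuous on \<open>{0..l}\<close>, so this is a
  proper integral. Here \<open>k\<close> is the modulus (not the parameter \<open>m = k\<^sup>2\<close>), and \<open>l\<close> is the sine of
  the amplitude.\<close>

definition ellF :: "real \<Rightarrow> real \<Rightarrow> real" where
  "ellF l k = integral {0..l} (\<lambda>t. 1 / sqrt ((1 - t^2) * (1 - k^2 * t^2)))"

definition coeff_a :: "nat \<Rightarrow> real \<Rightarrow> real" where
  "coeff_a n x = 8 * real n ^ 2 + 36 * real n + 42 - x * (2 * real n + 5)^2"

definition coeff_b :: "nat \<Rightarrow> real \<Rightarrow> real" where
  "coeff_b n x = 2 * x * (4 * real n ^ 2 + 14 * real n + 13) - (2 * real n + 3)^2"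

definition coeff_c :: "nat \<Rightarrow> real \<Rightarrow> real" where
  "coeff_c n x = - 4 * x * (real n + 1)^2"

definition coeff_h :: "nat \<Rightarrow> real \<Rightarrow> real" where
  "coeff_h n x =
     (x * (2 * real n + 5) * (2 * real n + 3)^2
       + (real n + 3) * (8 * real n ^ 2 + 24 * real n + 17))
     / (8 * (real n + 3) * (fact (n + 2))^2)
     * (pochhammer (3/2) n)^2 * (- x) ^ (n + 2)"

text \<open>The last equation is the four-term recurrence solved for the highest index. The functions are
  meant for \<open>x \<ge> 0\<close>; they are real-valued total functions only by convention.\<close>

fun s_fun :: "nat \<Rightarrow> real \<Rightarrow> real" where
  "s_fun 0 x = - 2 * ln ((1 + sqrt (1 + x)) / 2)"
| "s_fun (Suc 0) x =
     (x / 2 - 1) * ln ((1 + sqrt (1 + x)) / 2) - 1/2 * sqrt (1 + x) + 1/2 + x / 2"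
| "s_fun (Suc (Suc 0)) x =
     (- (9/32) * x^2 + x / 4 - 3/4) * ln ((1 + sqrt (1 + x)) / 2)
     + (9/32 * x - 7/16) * sqrt (1 + x) + 7/16 + 1/8 * x - 21/64 * x^2"
| "s_fun (Suc (Suc (Suc n))) x =
     (coeff_a n x * s_fun (Suc (Suc n)) x + coeff_b n x * s_fun (Suc n) x
       + coeff_c n x * s_fun n x + coeff_h n x) / (4 * (real n + 3)^2)"

definition ellF_remainder :: "nat \<Rightarrow> real \<Rightarrow> real \<Rightarrow> real" where
  "ellF_remainder N l k = ellF l k -
     (1/2 * ln ((1 + l) / (1 - l)) *
        (\<Sum>j=0..N. pochhammer (1/2) j * pochhammer (1/2) j / (fact j)^2 * (1 - k^2)^j)
      + 1 / (2 * l) *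
        (\<Sum>n<N. ((1 - l^2) / (- (l^2)))^n * s_fun n ((1 - k^2) * l^2 / (1 - l^2))))"

definition alpha :: "nat \<Rightarrow> real" where
  "alpha N = (real N + 1/2)^2 / (real N + 1)^2"

definition f_bound :: "nat \<Rightarrow> real \<Rightarrow> real \<Rightarrow> real" where
  "f_bound N l k =
     (let \<alpha> = alpha N; q = sqrt (1 + (1 - l^2) / (\<alpha> * l^2 * (1 - k^2)))
      in 1 / (1 - \<alpha> * (1 - k^2)) *
         (1 / (\<alpha> * l * q) * ln ((q + 1) / (q - 1)) - (1 - k^2) * ln ((1 + l) / (1 - l))))"

end

theory Submission
  imports Defs "HOL-Real_Asymp.Real_Asymp"
begin

text \<open>Let \<open>m = 1 - k\<^sup>2\<close>, \<open>x = m l\<^sup>2 / (1 - l\<^sup>2)\<close> and \<open>X u = x (1 - u\<^sup>2)\<close>, and let \<open>\<sigma>\<close> be the product of two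
  independent arcsine-distributed variables, so that \<open>E \<sigma> ^ j = ((1/2)\<^sub>j / j!)\<^sup>2\<close>. Applying
  \<open>E (1 / (1 + z s)) = 1 / sqrt (1 + z)\<close> twice, with a substitution in between, gives
  \<open>F(l, k) = \<integral>\<^sub>0\<^sup>1 l / (1 - l\<^sup>2 u\<^sup>2) E (1 / (1 + X u \<sigma>)) du\<close>. Splitting off
  \<open>\<sigma> ^ n / (1 + X \<sigma>) = \<sigma> ^ n - X \<sigma> ^ (n + 1) / (1 + X \<sigma>)\<close> repeatedly produces the logarithmic terms, the terms
  \<open>s_n(x) = 2 E (w ^ (n + 1) \<integral>\<^sub>0\<^sup>1 du / (1 - w (1 - u\<^sup>2)))\<close> with \<open>w = - x \<sigma>\<close>, and a remainder governed by
  \<open>E (\<sigma> ^ (N + 1) / (1 + X \<sigma>))\<close>. Jensen's inequality bounds the latter by Cauchy kernels in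
  \<open>X\<close>, whose integrals are the functions \<open>f_N\<close>.

  That the \<open>s_n\<close> have this integral form follows from the identity
  \<open>E ((\<theta> + 1/2)\<^sup>2 p(\<sigma>)) = E (\<sigma> (\<theta> + 1)\<^sup>2 p(\<sigma>))\<close>, with \<open>\<theta> = \<sigma> d/d\<sigma>\<close>, obtained by two integrations by
  parts: applied to \<open>w ^ (n + 1) (1 - w)\<^sup>2 \<integral>\<^sub>0\<^sup>1 du / (1 - w (1 - u\<^sup>2))\<close> it is the four-term recurrence, and with
  \<open>n = - 1\<close> it yields \<open>s_2\<close> from \<open>s_0\<close> and \<open>s_1\<close>, which in turn satisfy first-order differential equations.\<close>

subsection \<open>Arcsine means\<close>

text \<open>The substitution \<open>s = (sin phi)^2\<close> turns the arcsine density
  \<open>1 / (pi * sqrt (s * (1 - s)))\<close> into a constant one, so a continuous \<open>f\<close>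
  leads to a proper integral without endpoint singularities.\<close>

definition arcsine_mean :: "(real \<Rightarrow> real) \<Rightarrow> real" where
  "arcsine_mean f = 2 / pi * integral {0..pi/2} (\<lambda>\<phi>. f ((sin \<phi>)\<^sup>2))"

lemma sin_sq_mem_unit: "(sin (\<phi>::real))\<^sup>2 \<in> {0..1}"
  by (simp add: abs_square_le_1)

lemma continuous_on_sin_sq:
  assumes "continuous_on {0..1::real} f"
  shows "continuous_on A (\<lambda>\<phi>::real. f ((sin \<phi>)\<^sup>2) :: real)"
  by (rule continuous_on_compose2[OF assms]) (use sin_sq_mem_unit in \<open>auto intro!: continuous_intros\<close>)

lemma integrable_sin_sq:
  assumes "continuous_on {0..1::real} f"
  shows "(\<lambda>\<phi>::real. f ((sin \<phi>)\<^sup>2) :: real) integrable_on {0..pi/2}"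
  by (intro integrable_continuous_real continuous_on_sin_sq assms)

lemma arcsine_mean_cong:
  assumes "\<And>s. s \<in> {0..1} \<Longrightarrow> f s = g s"
  shows "arcsine_mean f = arcsine_mean g"
proof -
  have "f ((sin \<phi>)\<^sup>2) = g ((sin \<phi>)\<^sup>2)" for \<phi> :: real
    by (rule assms[OF sin_sq_mem_unit])
  thus ?thesis by (simp add: arcsine_mean_def)
qed

lemma arcsine_mean_add:
  assumes "continuous_on {0..1} f" "continuous_on {0..1} g"
  shows "arcsine_mean (\<lambda>s. f s + g s) = arcsine_mean f + arcsine_mean g"
  using integral_add[OF integrable_sin_sq integrable_sin_sq, OF assms]
  by (simp add: arcsine_mean_def algebra_simps)

lemma arcsine_mean_cmult: "arcsine_mean (\<lambda>s. c * f s) = c * arcsine_mean f"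
  by (simp add: arcsine_mean_def)

lemma arcsine_mean_const [simp]: "arcsine_mean (\<lambda>_. c) = c"
  by (simp add: arcsine_mean_def)

lemma arcsine_mean_mono:
  assumes "continuous_on {0..1} f" "continuous_on {0..1} g" "\<And>s. s \<in> {0..1} \<Longrightarrow> f s \<le> g s"
  shows "arcsine_mean f \<le> arcsine_mean g"
  unfolding arcsine_mean_def
  by (intro mult_left_mono integral_le integrable_sin_sq assms sin_sq_mem_unit) auto

text \<open>The parameter type is left general because the parameter is itself a pair wherever means
  and integrals are nested.\<close>

lemma continuous_on_arcsine_mean:
  fixes f :: "'a::t2_space \<Rightarrow> real \<Rightarrow> real"
  assumes "continuous_on (U \<times> {0..1}) (\<lambda>(x, s). f x s)"
  shows "continuous_on U (\<lambda>x. arcsine_mean (f x))"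
proof -
  have "continuous_on (U \<times> cbox 0 (pi/2)) (\<lambda>y. (\<lambda>(x, s). f x s) (fst y, (sin (snd y))\<^sup>2))"
    by (rule continuous_on_compose2[OF assms])
       (use sin_sq_mem_unit in \<open>auto intro!: continuous_intros\<close>)
  hence "continuous_on (U \<times> cbox 0 (pi/2)) (\<lambda>(x, \<phi>). f x ((sin \<phi>)\<^sup>2))"
    by (simp add: case_prod_unfold)
  from integral_continuous_on_param[OF this] show ?thesis
    unfolding arcsine_mean_def by (intro continuous_intros) simp_all
qed

lemma has_field_derivative_arcsine_mean:
  fixes f :: "real \<Rightarrow> real \<Rightarrow> real"
  assumes "\<And>x s. x \<in> U \<Longrightarrow> s \<in> {0..1} \<Longrightarrow> ((\<lambda>x. f x s) has_field_derivative f' x s) (at x within U)"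
    and "\<And>x. x \<in> U \<Longrightarrow> continuous_on {0..1} (f x)"
    and "continuous_on (U \<times> {0..1}) (\<lambda>(x, s). f' x s)"
    and "x0 \<in> U" "convex U"
  shows "((\<lambda>x. arcsine_mean (f x)) has_field_derivative arcsine_mean (f' x0)) (at x0 within U)"
proof -
  have "continuous_on (U \<times> cbox 0 (pi/2)) (\<lambda>y. (\<lambda>(x, s). f' x s) (fst y, (sin (snd y))\<^sup>2))"
    by (rule continuous_on_compose2[OF assms(3)])
       (use sin_sq_mem_unit in \<open>auto intro!: continuous_intros\<close>)
  hence c: "continuous_on (U \<times> cbox 0 (pi/2)) (\<lambda>(x, \<phi>). f' x ((sin \<phi>)\<^sup>2))"
    by (simp add: case_prod_unfold)
  have "((\<lambda>x. integral (cbox 0 (pi/2)) (\<lambda>\<phi>. f x ((sin \<phi>)\<^sup>2))) has_field_derivative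
      integral (cbox 0 (pi/2)) (\<lambda>\<phi>. f' x0 ((sin \<phi>)\<^sup>2))) (at x0 within U)"
    using c assms(4,5)
    by (intro leibniz_rule_field_derivative)
       (auto intro!: assms(1) sin_sq_mem_unit integrable_sin_sq[OF assms(2)] simp: abs_square_le_1)
  thus ?thesis unfolding arcsine_mean_def by (intro DERIV_cmult) simp
qed

lemma arcsine_mean_integral_swap:
  fixes f :: "real \<Rightarrow> real \<Rightarrow> real"
  assumes "continuous_on ({0..1} \<times> {a..b}) (\<lambda>(s, u). f s u)"
  shows "arcsine_mean (\<lambda>s. integral {a..b} (f s)) = integral {a..b} (\<lambda>u. arcsine_mean (\<lambda>s. f s u))"
proof -
  have "continuous_on (cbox (0, a) (pi/2, b)) (\<lambda>y. (\<lambda>(s, u). f s u) ((sin (fst y))\<^sup>2, snd y))"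
    by (rule continuous_on_compose2[OF assms])
       (use sin_sq_mem_unit in \<open>auto intro!: continuous_intros simp: cbox_Pair_eq\<close>)
  hence "continuous_on (cbox (0, a) (pi/2, b)) (\<lambda>(\<phi>, u). f ((sin \<phi>)\<^sup>2) u)"
    by (simp add: case_prod_unfold)
  from integral_swap_continuous[OF this] show ?thesis
    by (simp add: arcsine_mean_def)
qed

lemma arcsine_mean_swap:
  fixes f :: "real \<Rightarrow> real \<Rightarrow> real"
  assumes "continuous_on ({0..1} \<times> {0..1}) (\<lambda>(s, t). f s t)"
  shows "arcsine_mean (\<lambda>s. arcsine_mean (f s)) = arcsine_mean (\<lambda>t. arcsine_mean (\<lambda>s. f s t))"
proof -
  have "continuous_on ({0..1} \<times> {0..pi/2}) (\<lambda>y. (\<lambda>(s, t). f s t) (fst y, (sin (snd y))\<^sup>2))"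
    by (rule continuous_on_compose2[OF assms])
       (use sin_sq_mem_unit in \<open>auto intro!: continuous_intros\<close>)
  hence "continuous_on ({0..1} \<times> {0..pi/2}) (\<lambda>(s, \<phi>). f s ((sin \<phi>)\<^sup>2))"
    by (simp add: case_prod_unfold)
  from arcsine_mean_integral_swap[OF this] show ?thesis
    by (simp add: arcsine_mean_def[of "f _"] arcsine_mean_cmult)
       (simp add: arcsine_mean_def)
qed

text \<open>With \<open>\<theta> = s d/ds\<close> and \<open>q1 = \<theta> q\<close> this reads
  \<open>E ((\<theta> + 1/2) q) = E (s (\<theta> + 1) q)\<close>. It comes from integrating the
  derivative of \<open>sin \<phi> * cos \<phi> * q ((sin \<phi>)\<^sup>2)\<close>, which vanishes at
  both \<open>0\<close> and \<open>pi/2\<close>.\<close>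

lemma arcsine_mean_by_parts:
  fixes q D q1 :: "real \<Rightarrow> real"
  assumes "continuous_on {0..1} q" "continuous_on {0..1} q1"
    and D: "\<And>s. s \<in> {0..1} \<Longrightarrow> (q has_field_derivative D s) (at s)"
    and q1: "\<And>s. s \<in> {0..1} \<Longrightarrow> s * D s = q1 s"
  shows "arcsine_mean (\<lambda>s. q1 s + q s / 2) = arcsine_mean (\<lambda>s. s * (q1 s + q s))"
proof -
  let ?g = "\<lambda>s. 2 * ((q1 s + q s / 2) - s * (q1 s + q s))"
  have "((\<lambda>\<phi>. ?g ((sin \<phi>)\<^sup>2)) has_integral
      (sin (pi/2) * cos (pi/2) * q ((sin (pi/2))\<^sup>2) - sin 0 * cos 0 * q ((sin 0)\<^sup>2))) {0..pi/2}"
  proof (rule fundamental_theorem_of_calculus)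
    fix \<phi> :: real assume "\<phi> \<in> {0..pi/2}"
    let ?s = "(sin \<phi>)\<^sup>2"
    have "((\<lambda>\<phi>. q ((sin \<phi>)\<^sup>2)) has_field_derivative D ?s * (2 * sin \<phi> * cos \<phi>)) (at \<phi>)"
      by (rule DERIV_chain2[where f = q and g = "\<lambda>\<phi>. (sin \<phi>)\<^sup>2", OF D[OF sin_sq_mem_unit]])
        (auto intro!: derivative_eq_intros)
    hence "((\<lambda>\<phi>. sin \<phi> * cos \<phi> * q ((sin \<phi>)\<^sup>2)) has_field_derivative
        (sin \<phi> * cos \<phi> * (D ?s * (2 * sin \<phi> * cos \<phi>)) + (cos \<phi> * cos \<phi> - sin \<phi> * sin \<phi>) * q ?s)) (at \<phi>)"
      by (auto intro!: derivative_eq_intros simp: algebra_simps)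
    also have "sin \<phi> * cos \<phi> * (D ?s * (2 * sin \<phi> * cos \<phi>)) + (cos \<phi> * cos \<phi> - sin \<phi> * sin \<phi>) * q ?s
      = 2 * (cos \<phi>)\<^sup>2 * (?s * D ?s) + ((cos \<phi>)\<^sup>2 - ?s) * q ?s"
      by (simp add: power2_eq_square algebra_simps)
    also have "\<dots> = ?g ?s"
      by (simp add: q1[OF sin_sq_mem_unit] cos_squared_eq algebra_simps)
    finally show "((\<lambda>\<phi>. sin \<phi> * cos \<phi> * q ((sin \<phi>)\<^sup>2)) has_vector_derivative ?g ?s) (at \<phi> within {0..pi/2})"
      unfolding has_real_derivative_iff_has_vector_derivative
      by (rule has_vector_derivative_at_within)
  qed simp
  hence "arcsine_mean ?g = 0"
    by (simp add: arcsine_mean_def integral_unique)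
  hence "arcsine_mean (\<lambda>s. (q1 s + q s / 2) - s * (q1 s + q s)) = 0"
    by (subst (asm) arcsine_mean_cmult) simp
  moreover have "arcsine_mean (\<lambda>s. (q1 s + q s / 2)) = arcsine_mean (\<lambda>s. ((q1 s + q s / 2) - s * (q1 s + q s)) + s * (q1 s + q s))"
    by simp
  ultimately show ?thesis
    by (subst (asm) arcsine_mean_add) (auto intro!: continuous_intros assms)
qed

text \<open>For \<open>q = s ^ j\<close> one has \<open>\<theta> q = j q\<close>, so integration by
  parts becomes a two-term recurrence with ratio \<open>(j + 1/2) / (j + 1)\<close>, which is also
  the ratio of consecutive values on the right.\<close>

lemma arcsine_mean_power: "arcsine_mean (\<lambda>s. s ^ j) = pochhammer (1/2) j / fact j"
proof (induction j)
  case (Suc j)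
  have "arcsine_mean (\<lambda>s. real j * s ^ j + s ^ j / 2) = arcsine_mean (\<lambda>s. s * (real j * s ^ j + s ^ j))"
  proof (rule arcsine_mean_by_parts)
    show "((\<lambda>s. s ^ j) has_field_derivative real j * s ^ (j - 1)) (at s)" for s :: real
      by (auto intro!: derivative_eq_intros)
    show "s * (real j * s ^ (j - 1)) = real j * s ^ j" for s :: real
      by (cases j) auto
  qed (auto intro!: continuous_intros)
  also have "(\<lambda>s::real. real j * s ^ j + s ^ j / 2) = (\<lambda>s. (real j + 1/2) * s ^ j)"
    by (auto simp: algebra_simps)
  also have "(\<lambda>s::real. s * (real j * s ^ j + s ^ j)) = (\<lambda>s. (real j + 1) * s ^ Suc j)"
    by (auto simp: algebra_simps)
  finally have "(real j + 1/2) * (pochhammer (1/2) j / fact j) = (real j + 1) * arcsine_mean (\<lambda>s. s ^ Suc j)"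
    unfolding arcsine_mean_cmult Suc.IH .
  hence "arcsine_mean (\<lambda>s. s ^ Suc j) = (real j + 1/2) * (pochhammer (1/2) j / fact j) / (real j + 1)"
    by (subst eq_divide_eq) (auto simp del: power_Suc)
  also have "\<dots> = pochhammer (1/2) (Suc j) / fact (Suc j)"
    unfolding pochhammer_Suc fact_Suc by (simp add: add.commute mult.commute)
  finally show ?case .
qed simp

text \<open>With \<open>r = sqrt (1 + z)\<close> the integrand is
  \<open>1 / (cos^2 + r^2 sin^2)\<close>. The addition theorem writes
  \<open>arctan (r * tan \<phi>) - \<phi>\<close> as \<open>arctan (N \<phi> / Q \<phi>)\<close>,
  where \<open>Q \<phi> > 0\<close> throughout.\<close>

lemma arcsine_mean_cauchy_kernel:
  assumes "z \<ge> 0"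
  shows "arcsine_mean (\<lambda>s. 1 / (1 + z * s)) = 1 / sqrt (1 + z)"
proof -
  define r where "r = sqrt (1 + z)"
  have r: "r > 0" "r\<^sup>2 = 1 + z" using assms by (auto simp: r_def)
  define Q N where "Q = (\<lambda>\<phi>::real. (cos \<phi>)\<^sup>2 + r * (sin \<phi>)\<^sup>2)" and "N = (\<lambda>\<phi>. (r - 1) * sin \<phi> * cos \<phi>)"
  \<comment> \<open>A branch of \<open>arctan (r * tan \<phi>) / r\<close> that is smooth at \<open>\<pi>/2\<close>.\<close>
  let ?G = "\<lambda>\<phi>. (\<phi> + arctan (N \<phi> / Q \<phi>)) / r"
  have "((\<lambda>\<phi>. 1 / (1 + z * (sin \<phi>)\<^sup>2)) has_integral (?G (pi/2) - ?G 0)) {0..pi/2}"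
  proof (rule fundamental_theorem_of_calculus)
    fix \<phi> :: real
    let ?s = "sin \<phi>" and ?c = "cos \<phi>"
    have sc: "?s^2 = 1 - ?c^2" by (simp add: sin_squared_eq)
    have Q: "Q \<phi> > 0"
      using r(1) by (cases "?c = 0") (auto simp: Q_def sin_squared_eq[of \<phi>] abs_square_le_1 intro!: add_pos_nonneg)
    \<comment> \<open>Here
      \<open>Q + i N = (cos \<phi> + i r sin \<phi>) * exp (- i \<phi>)\<close>; the equation
      compares squared moduli.\<close>
    have QN: "(Q \<phi>)\<^sup>2 + (N \<phi>)\<^sup>2 = ?c^2 + r^2 * ?s^2"
      unfolding Q_def N_def power_mult_distrib sc by (simp add: power2_eq_square algebra_simps)
    have pos: "?c^2 + r^2 * ?s^2 > 0"
      using QN Q by (smt (verit) zero_less_power2 zero_le_power2)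
    have D: "((\<lambda>\<phi>. N \<phi> / Q \<phi>) has_field_derivative
      ((r - 1) * (?c^2 - ?s^2) * Q \<phi> - N \<phi> * (2 * (r - 1) * ?s * ?c)) / (Q \<phi>)^2) (at \<phi>)"
      using Q unfolding N_def Q_def
      by (auto intro!: derivative_eq_intros simp: power2_eq_square algebra_simps)
    have "(r - 1) * (?c^2 - ?s^2) * Q \<phi> - N \<phi> * (2 * (r - 1) * ?s * ?c)
      = (r - 1) * (?c^2 - ?s^2) * (?c^2 + r * ?s^2) - 2 * (r - 1)^2 * ?s^2 * ?c^2"
      unfolding Q_def N_def by (simp add: power2_eq_square algebra_simps)
    also have "\<dots> = (r - 1) * (?c^2 - r * ?s^2)"
      unfolding sc by (simp add: power2_eq_square algebra_simps)
    finally have num: "(r - 1) * (?c^2 - ?s^2) * Q \<phi> - N \<phi> * (2 * (r - 1) * ?s * ?c) = (r - 1) * (?c^2 - r * ?s^2)" .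
    have "((\<lambda>\<phi>. arctan (N \<phi> / Q \<phi>)) has_field_derivative
      ((r - 1) * (?c^2 - r * ?s^2)) / (Q \<phi>)^2 / (1 + (N \<phi> / Q \<phi>)^2)) (at \<phi>)"
      using DERIV_chain2[OF DERIV_arctan D] unfolding num by (simp add: divide_inverse mult_ac)
    also have "((r - 1) * (?c^2 - r * ?s^2)) / (Q \<phi>)^2 / (1 + (N \<phi> / Q \<phi>)^2) =
       ((r - 1) * (?c^2 - r * ?s^2)) / (?c^2 + r^2 * ?s^2)"
    proof -
      have "1 + (N \<phi> / Q \<phi>)^2 = ((Q \<phi>)^2 + (N \<phi>)^2) / (Q \<phi>)^2"
        using Q by (simp add: power_divide add_divide_distrib)
      thus ?thesis using Q by (simp add: QN)
    qed
    finally have "(?G has_field_derivative (1 + ((r - 1) * (?c^2 - r * ?s^2)) / (?c^2 + r^2 * ?s^2)) / r) (at \<phi>)"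
      by (intro DERIV_cdivide DERIV_add DERIV_ident)
    also have "(1 + ((r - 1) * (?c^2 - r * ?s^2)) / (?c^2 + r^2 * ?s^2)) / r = 1 / (?c^2 + r^2 * ?s^2)"
    proof -
      have "(?c^2 + r^2 * ?s^2) + (r - 1) * (?c^2 - r * ?s^2) = r"
        unfolding sc by (simp add: power2_eq_square algebra_simps)
      hence "1 + ((r - 1) * (?c^2 - r * ?s^2)) / (?c^2 + r^2 * ?s^2) = r / (?c^2 + r^2 * ?s^2)"
        using pos by (simp add: add_divide_eq_iff)
      thus ?thesis using r(1) by simp
    qed
    also have "?c^2 + r^2 * ?s^2 = 1 + z * ?s^2"
      unfolding r(2) by (simp add: algebra_simps)
    finally show "(?G has_vector_derivative 1 / (1 + z * ?s^2)) (at \<phi> within {0..pi/2})"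
      unfolding has_real_derivative_iff_has_vector_derivative
      by (rule has_vector_derivative_at_within)
  qed simp
  hence "integral {0..pi/2} (\<lambda>\<phi>. 1 / (1 + z * (sin \<phi>)\<^sup>2)) = pi / 2 / r"
    by (simp add: integral_unique N_def)
  thus ?thesis by (simp add: arcsine_mean_def r_def)
qed

section \<open>Means over the product of two independent arcsine variables\<close>

definition arcsine_prod_mean :: "(real \<Rightarrow> real) \<Rightarrow> real" where
  "arcsine_prod_mean f = arcsine_mean (\<lambda>s. arcsine_mean (\<lambda>t. f (s * t)))"

lemma mult_mem_unit: "s \<in> {0..1} \<Longrightarrow> t \<in> {0..1} \<Longrightarrow> s * t \<in> {0..1::real}"
  by (auto intro: mult_le_one)

lemma continuous_on_prod_kernel:
  assumes "continuous_on {0..1::real} f"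
  shows "continuous_on ({0..1} \<times> {0..1}) (\<lambda>(s, t). f (s * t) :: real)"
proof -
  have "continuous_on ({0..1} \<times> {0..1}) (\<lambda>y. f (fst y * snd y))"
    by (rule continuous_on_compose2[OF assms]) (use mult_mem_unit in \<open>auto intro!: continuous_intros\<close>)
  thus ?thesis by (simp add: case_prod_unfold)
qed

lemma continuous_on_prod_kernel_slice:
  assumes "continuous_on {0..1::real} f" "s \<in> {0..1}"
  shows "continuous_on {0..1} (\<lambda>t. f (s * t) :: real)"
  by (rule continuous_on_compose2[OF assms(1)]) (use assms(2) mult_mem_unit in \<open>auto intro!: continuous_intros\<close>)

lemma continuous_on_inner_mean:
  assumes "continuous_on {0..1::real} f"
  shows "continuous_on {0..1} (\<lambda>s. arcsine_mean (\<lambda>t. f (s * t)))"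
  by (rule continuous_on_arcsine_mean[OF continuous_on_prod_kernel[OF assms]])

lemma arcsine_prod_mean_cong:
  assumes "\<And>s. s \<in> {0..1} \<Longrightarrow> f s = g s"
  shows "arcsine_prod_mean f = arcsine_prod_mean g"
  unfolding arcsine_prod_mean_def by (intro arcsine_mean_cong assms mult_mem_unit)

lemma arcsine_prod_mean_add:
  assumes "continuous_on {0..1} f" "continuous_on {0..1} g"
  shows "arcsine_prod_mean (\<lambda>s. f s + g s) = arcsine_prod_mean f + arcsine_prod_mean g"
proof -
  have "arcsine_prod_mean (\<lambda>s. f s + g s)
      = arcsine_mean (\<lambda>s. arcsine_mean (\<lambda>t. f (s * t)) + arcsine_mean (\<lambda>t. g (s * t)))"
    unfolding arcsine_prod_mean_def
    by (intro arcsine_mean_cong arcsine_mean_add continuous_on_prod_kernel_slice assms)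
  thus ?thesis
    by (simp add: arcsine_mean_add continuous_on_inner_mean assms arcsine_prod_mean_def)
qed

lemma arcsine_prod_mean_cmult: "arcsine_prod_mean (\<lambda>s. c * f s) = c * arcsine_prod_mean f"
  by (simp add: arcsine_prod_mean_def arcsine_mean_cmult)

lemma arcsine_prod_mean_const [simp]: "arcsine_prod_mean (\<lambda>_. c) = c"
  by (simp add: arcsine_prod_mean_def)

lemma arcsine_prod_mean_mono:
  assumes "continuous_on {0..1} f" "continuous_on {0..1} g" "\<And>s. s \<in> {0..1} \<Longrightarrow> f s \<le> g s"
  shows "arcsine_prod_mean f \<le> arcsine_prod_mean g"
  unfolding arcsine_prod_mean_def
  by (intro arcsine_mean_mono continuous_on_inner_mean continuous_on_prod_kernel_slice assms mult_mem_unit)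

text \<open>These are the coefficients of \<open>k ^ (2 * j)\<close> in \<open>2 / pi\<close> times
  the complete elliptic integral \<open>K(k)\<close>; here they serve as the moments of the product
  variable.\<close>

definition legendre_coeff :: "nat \<Rightarrow> real" where
  "legendre_coeff j = (pochhammer (1/2) j / fact j)\<^sup>2"

lemma legendre_coeff_pos: "legendre_coeff j > 0"
  by (auto simp: legendre_coeff_def pochhammer_eq_0_iff)

lemma legendre_coeff_0 [simp]: "legendre_coeff 0 = 1"
  by (simp add: legendre_coeff_def)

lemma legendre_coeff_Suc: "legendre_coeff (Suc j) = ((real j + 1/2) / (real j + 1))\<^sup>2 * legendre_coeff j"
  by (simp add: legendre_coeff_def pochhammer_Suc power_mult_distrib power_divide add.commute)

text \<open>As a ratio of consecutive moments, \<open>alpha j\<close> is the mean of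
  \<open>\<sigma>\<close> under the law reweighted by \<open>\<sigma> ^ j\<close>. This is how the
  constant enters the bounds.\<close>

lemma legendre_coeff_Suc_alpha: "legendre_coeff (Suc j) = alpha j * legendre_coeff j"
  by (simp add: legendre_coeff_Suc alpha_def power_divide)

lemma arcsine_prod_mean_power: "arcsine_prod_mean (\<lambda>s. s ^ j) = legendre_coeff j"
proof -
  have "arcsine_prod_mean (\<lambda>s. s ^ j) = arcsine_mean (\<lambda>s. (pochhammer (1/2) j / fact j) * s ^ j)"
    by (simp add: arcsine_prod_mean_def power_mult_distrib arcsine_mean_cmult arcsine_mean_power mult.commute)
  thus ?thesis
    unfolding arcsine_mean_cmult by (simp only: arcsine_mean_power legendre_coeff_def power2_eq_square)
qed

lemma arcsine_prod_mean_integral_swap: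
  fixes f :: "real \<Rightarrow> real \<Rightarrow> real"
  assumes "continuous_on ({0..1} \<times> {a..b}) (\<lambda>(s, u). f s u)"
  shows "arcsine_prod_mean (\<lambda>s. integral {a..b} (f s)) = integral {a..b} (\<lambda>u. arcsine_prod_mean (\<lambda>s. f s u))"
proof -
  have "arcsine_mean (\<lambda>t. integral {a..b} (f (s * t)))
      = integral {a..b} (\<lambda>u. arcsine_mean (\<lambda>t. f (s * t) u))" if "s \<in> {0..1}" for s
  proof (rule arcsine_mean_integral_swap)
    have "continuous_on ({0..1} \<times> {a..b}) (\<lambda>y. (\<lambda>(s, u). f s u) (s * fst y, snd y))"
      by (rule continuous_on_compose2[OF assms])
         (use that mult_mem_unit in \<open>auto intro!: continuous_intros\<close>)
    thus "continuous_on ({0..1} \<times> {a..b}) (\<lambda>(t, u). f (s * t) u)"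
      by (simp add: case_prod_unfold)
  qed
  hence "arcsine_prod_mean (\<lambda>s. integral {a..b} (f s))
      = arcsine_mean (\<lambda>s. integral {a..b} (\<lambda>u. arcsine_mean (\<lambda>t. f (s * t) u)))"
    unfolding arcsine_prod_mean_def by (intro arcsine_mean_cong)
  also have "\<dots> = integral {a..b} (\<lambda>u. arcsine_mean (\<lambda>s. arcsine_mean (\<lambda>t. f (s * t) u)))"
  proof (rule arcsine_mean_integral_swap)
    have "continuous_on (({0..1} \<times> {a..b}) \<times> {0..1}) (\<lambda>y. (\<lambda>(s, u). f s u) (fst (fst y) * snd y, snd (fst y)))"
      by (rule continuous_on_compose2[OF assms])
         (use mult_mem_unit in \<open>auto intro!: continuous_intros\<close>)
    hence "continuous_on (({0..1} \<times> {a..b}) \<times> {0..1}) (\<lambda>(y, t). f (fst y * t) (snd y))"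
      by (simp add: case_prod_unfold)
    from continuous_on_arcsine_mean[OF this]
    show "continuous_on ({0..1} \<times> {a..b}) (\<lambda>(s, u). arcsine_mean (\<lambda>t. f (s * t) u))"
      by (simp add: case_prod_unfold)
  qed
  finally show ?thesis by (simp add: arcsine_prod_mean_def)
qed

text \<open>Here \<open>p1 = \<theta> p\<close> and \<open>p2 = \<theta> (\<theta> p)\<close>. On
  \<open>p (s * t)\<close> the Euler operators in \<open>s\<close> and in \<open>t\<close> agree, so
  each of the two one-variable integrations by parts trades one factor \<open>\<theta> + 1/2\<close>
  for \<open>\<theta> + 1\<close> and one of the variables \<open>t\<close>,
  \<open>s\<close>.\<close>

lemma arcsine_prod_mean_by_parts:
  fixes p p1 p2 D D1 :: "real \<Rightarrow> real"
  assumes c: "continuous_on {0..1} p" "continuous_on {0..1} p1" "continuous_on {0..1} p2"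
    and D: "\<And>s. s \<in> {0..1} \<Longrightarrow> (p has_field_derivative D s) (at s)"
      "\<And>s. s \<in> {0..1} \<Longrightarrow> (p1 has_field_derivative D1 s) (at s)"
    and p: "\<And>s. s \<in> {0..1} \<Longrightarrow> s * D s = p1 s" "\<And>s. s \<in> {0..1} \<Longrightarrow> s * D1 s = p2 s"
  shows "arcsine_prod_mean (\<lambda>s. p2 s + p1 s + p s / 4)
      = arcsine_prod_mean (\<lambda>s. s * (p2 s + 2 * p1 s + p s))"
proof -
  have chain: "((\<lambda>t. g (s * t)) has_field_derivative g' (s * t) * s) (at t)"
    if "\<And>s. s \<in> {0..1} \<Longrightarrow> (g has_field_derivative g' s) (at s)" "s \<in> {0..1}" "t \<in> {0..1}"
    for g g' :: "real \<Rightarrow> real" and s t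
    by (rule DERIV_chain2[where f = g and g = "\<lambda>t. s * t", OF that(1)])
       (use that mult_mem_unit in \<open>auto intro!: derivative_eq_intros\<close>)
  \<comment> \<open>This is \<open>(\<theta> + 1/2) (\<theta> + 1) p\<close>, the state after the
    integration by parts in \<open>t\<close> and before the one in \<open>s\<close>.\<close>
  let ?r = "\<lambda>\<sigma>. p2 \<sigma> + 3/2 * p1 \<sigma> + p \<sigma> / 2"
  have *: "arcsine_mean (\<lambda>t. p2 (s * t) + p1 (s * t) + p (s * t) / 4)
      = arcsine_mean (\<lambda>t. t * ?r (s * t))" if s: "s \<in> {0..1}" for s
  proof -
    have "arcsine_mean (\<lambda>t. (p2 (s * t) + p1 (s * t) / 2) + (p1 (s * t) + p (s * t) / 2) / 2)
      = arcsine_mean (\<lambda>t. t * ((p2 (s * t) + p1 (s * t) / 2) + (p1 (s * t) + p (s * t) / 2)))"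
    proof (rule arcsine_mean_by_parts)
      fix t :: real assume t: "t \<in> {0..1}"
      show "((\<lambda>t. p1 (s * t) + p (s * t) / 2) has_field_derivative D1 (s * t) * s + D (s * t) * s / 2) (at t)"
        using chain[OF D(1) s t] chain[OF D(2) s t] by (intro DERIV_add DERIV_cdivide)
      show "t * (D1 (s * t) * s + D (s * t) * s / 2) = p2 (s * t) + p1 (s * t) / 2"
        using p(1)[OF mult_mem_unit[OF s t]] p(2)[OF mult_mem_unit[OF s t]] by (simp add: algebra_simps)
    qed (intro continuous_intros continuous_on_prod_kernel_slice c s; simp)+
    thus ?thesis by (simp add: add_divide_distrib algebra_simps)
  qed
  have **: "arcsine_mean (\<lambda>s. ?r (s * t))
      = arcsine_mean (\<lambda>s. s * (p2 (s * t) + 2 * p1 (s * t) + p (s * t)))" if t: "t \<in> {0..1}" for t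
  proof -
    have "arcsine_mean (\<lambda>s. (p2 (t * s) + p1 (t * s)) + (p1 (t * s) + p (t * s)) / 2)
      = arcsine_mean (\<lambda>s. s * ((p2 (t * s) + p1 (t * s)) + (p1 (t * s) + p (t * s))))"
    proof (rule arcsine_mean_by_parts)
      fix s :: real assume s: "s \<in> {0..1}"
      show "((\<lambda>s. p1 (t * s) + p (t * s)) has_field_derivative D1 (t * s) * t + D (t * s) * t) (at s)"
        using chain[OF D(1) t s] chain[OF D(2) t s] by (intro DERIV_add)
      show "s * (D1 (t * s) * t + D (t * s) * t) = p2 (t * s) + p1 (t * s)"
        using p(1)[OF mult_mem_unit[OF t s]] p(2)[OF mult_mem_unit[OF t s]] by (simp add: algebra_simps)
    qed (intro continuous_intros continuous_on_prod_kernel_slice c t; simp)+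
    thus ?thesis by (simp add: mult.commute[of t] add_divide_distrib algebra_simps)
  qed
  have "arcsine_prod_mean (\<lambda>s. p2 s + p1 s + p s / 4)
      = arcsine_mean (\<lambda>s. arcsine_mean (\<lambda>t. t * ?r (s * t)))"
    unfolding arcsine_prod_mean_def by (intro arcsine_mean_cong *)
  \<comment> \<open>The order is exchanged so that \<open>s\<close> becomes the inner variable, with
    the factor \<open>t\<close> constant for it.\<close>
  also have "\<dots> = arcsine_mean (\<lambda>t. arcsine_mean (\<lambda>s. t * ?r (s * t)))"
  proof (rule arcsine_mean_swap)
    have "continuous_on {0..1} ?r" by (intro continuous_intros c; simp)
    from continuous_on_prod_kernel[OF this]
    have "continuous_on ({0..1} \<times> {0..1}) (\<lambda>y. snd y * ?r (fst y * snd y))"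
      by (intro continuous_on_mult continuous_on_snd continuous_on_id) (simp add: case_prod_unfold)
    thus "continuous_on ({0..1} \<times> {0..1}) (\<lambda>(s, t). t * ?r (s * t))"
      by (simp add: case_prod_unfold)
  qed
  also have "\<dots> = arcsine_mean (\<lambda>t. arcsine_mean (\<lambda>s. t * (s * (p2 (s * t) + 2 * p1 (s * t) + p (s * t)))))"
    unfolding arcsine_mean_cmult using ** by (intro arcsine_mean_cong) simp
  also have "\<dots> = arcsine_prod_mean (\<lambda>s. s * (p2 s + 2 * p1 s + p s))"
    by (simp add: arcsine_prod_mean_def mult_ac)
  finally show ?thesis .
qed

subsection \<open>The logarithmic kernel and its moments\<close>

text \<open>For \<open>w = - z < 0\<close> this equals
  \<open>arsinh (sqrt z) / sqrt (z * (1 + z))\<close>; the integral form is smooth through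
  \<open>w = 0\<close> and can be swapped with the means.\<close>

definition log_kernel :: "real \<Rightarrow> real" where
  "log_kernel w = integral {0..1} (\<lambda>u. 1 / (1 - w * (1 - u\<^sup>2)))"

definition log_kernel' :: "real \<Rightarrow> real" where
  "log_kernel' w = integral {0..1} (\<lambda>u. (1 - u\<^sup>2) / (1 - w * (1 - u\<^sup>2))\<^sup>2)"

lemma log_kernel_denom_pos:
  fixes u w :: real
  assumes "u \<in> {0..1}" "w < 1"
  shows "1 - w * (1 - u\<^sup>2) > 0"
proof (cases "w \<le> 0")
  case True
  have "w * (1 - u\<^sup>2) \<le> 0"
    using True assms by (intro mult_nonpos_nonneg) (auto simp: abs_square_le_1)
  thus ?thesis by linarith
next
  case False
  have "w * (1 - u\<^sup>2) \<le> w * 1"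
    using False by (intro mult_left_mono) auto
  thus ?thesis using assms by linarith
qed

lemma has_field_derivative_log_kernel:
  assumes "w < 1"
  shows "(log_kernel has_field_derivative log_kernel' w) (at w)"
proof -
  have "((\<lambda>w. integral (cbox 0 1) (\<lambda>u. 1 / (1 - w * (1 - u\<^sup>2)))) has_field_derivative
     integral (cbox 0 1) (\<lambda>u. (1 - u\<^sup>2) / (1 - w * (1 - u\<^sup>2))\<^sup>2)) (at w within {..<1})"
  proof (rule leibniz_rule_field_derivative)
    fix v u :: real assume *: "v \<in> {..<1}" "u \<in> cbox 0 1"
    have "1 - v * (1 - u\<^sup>2) \<noteq> 0"
      using log_kernel_denom_pos[of u v] * by auto
    thus "((\<lambda>v. 1 / (1 - v * (1 - u\<^sup>2))) has_field_derivative (1 - u\<^sup>2) / (1 - v * (1 - u\<^sup>2))\<^sup>2) (at v within {..<1})"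
      by (auto intro!: derivative_eq_intros simp: power2_eq_square)
  next
    fix v :: real assume "v \<in> {..<1}"
    thus "(\<lambda>u. 1 / (1 - v * (1 - u\<^sup>2))) integrable_on cbox 0 1"
      by (auto intro!: integrable_continuous_real continuous_intros dest: log_kernel_denom_pos[of _ v])
  next
    have "continuous_on ({..<1} \<times> cbox 0 1) (\<lambda>y. (1 - (snd y)\<^sup>2) / (1 - (fst y) * (1 - (snd y)\<^sup>2))\<^sup>2 :: real)"
      by (auto intro!: continuous_intros dest: log_kernel_denom_pos)
    thus "continuous_on ({..<1} \<times> cbox 0 1) (\<lambda>(w, u). (1 - u\<^sup>2) / (1 - w * (1 - u\<^sup>2))\<^sup>2 :: real)"
      by (simp add: case_prod_unfold)
  qed (use assms in auto)
  moreover have "open {..<1::real}" "w \<in> {..<1}" using assms by auto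
  ultimately show ?thesis
    by (simp add: log_kernel_def[abs_def] log_kernel'_def at_within_open[of _ "{..<1}"])
qed

text \<open>Integrate the derivative of \<open>u / (1 - w * (1 - u^2))\<close> over the unit
  interval and express it through the integrands of \<open>log_kernel\<close> and
  \<open>log_kernel'\<close>. The boundary value \<open>1\<close> at \<open>u = 1\<close> produces
  the inhomogeneous term.\<close>

lemma log_kernel_ode:
  assumes "w < 1"
  shows "w * (1 - w) * log_kernel' w = (w - 1/2) * log_kernel w + 1/2"
proof -
  let ?d = "\<lambda>u::real. 1 - w * (1 - u\<^sup>2)"
  have int: "(\<lambda>u. (1 - u\<^sup>2) / (?d u)\<^sup>2) integrable_on {0..1}" "(\<lambda>u. 1 / ?d u) integrable_on {0..1}"
    using assms by (auto intro!: integrable_continuous_real continuous_intros dest: log_kernel_denom_pos[of _ w])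
  have "((\<lambda>u. 2 * w * (1 - w) * ((1 - u\<^sup>2) / (?d u)\<^sup>2) - (2 * w - 1) * (1 / ?d u)) has_integral 1 / ?d 1 - 0 / ?d 0) {0..1}"
  proof (rule fundamental_theorem_of_calculus)
    fix u :: real assume "u \<in> {0..1}"
    hence d: "?d u > 0" using log_kernel_denom_pos assms by blast
    have "((\<lambda>u. u / ?d u) has_field_derivative (?d u - u * (2 * w * u)) / (?d u)\<^sup>2) (at u)"
      using d by (auto intro!: derivative_eq_intros simp: power2_eq_square algebra_simps)
    also have "(?d u - u * (2 * w * u)) / (?d u)\<^sup>2 = (2 * w * (1 - w) * (1 - u\<^sup>2) - (2 * w - 1) * ?d u) / (?d u)\<^sup>2"
      by (simp add: power2_eq_square algebra_simps)
    also have "\<dots> = 2 * w * (1 - w) * ((1 - u\<^sup>2) / (?d u)\<^sup>2) - (2 * w - 1) * (1 / ?d u)"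
    proof -
      have "(a * b - c * d) / d\<^sup>2 = a * (b / d\<^sup>2) - c * (1 / d)" if "d > 0" for a b c d :: real
        using that by (simp add: diff_divide_distrib power2_eq_square)
      from this[OF d] show ?thesis .
    qed
    finally show "((\<lambda>u. u / ?d u) has_vector_derivative
        2 * w * (1 - w) * ((1 - u\<^sup>2) / (?d u)\<^sup>2) - (2 * w - 1) * (1 / ?d u)) (at u within {0..1})"
      unfolding has_real_derivative_iff_has_vector_derivative
      by (rule has_vector_derivative_at_within)
  qed simp
  moreover have "((\<lambda>u. 2 * w * (1 - w) * ((1 - u\<^sup>2) / (?d u)\<^sup>2) - (2 * w - 1) * (1 / ?d u)) has_integral
      2 * w * (1 - w) * log_kernel' w - (2 * w - 1) * log_kernel w) {0..1}"
    unfolding log_kernel_def log_kernel'_def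
    by (intro has_integral_diff has_integral_mult_right integrable_integral int)
  ultimately have "2 * w * (1 - w) * log_kernel' w - (2 * w - 1) * log_kernel w = 1"
    by (simp add: has_integral_unique)
  thus ?thesis by (simp add: algebra_simps)
qed

lemma log_kernel_bounds:
  assumes "w \<le> 0"
  shows "log_kernel w \<in> {0..1}"
proof -
  have *: "1 \<le> 1 - w * (1 - u\<^sup>2)" if "u \<in> {0..1}" for u
    using assms that by (auto intro!: mult_nonpos_nonneg simp: abs_square_le_1)
  have i: "(\<lambda>u. 1 / (1 - w * (1 - u\<^sup>2))) integrable_on {0..1}"
    using assms by (auto intro!: integrable_continuous_real continuous_intros dest: log_kernel_denom_pos[of _ w])
  have "log_kernel w \<le> integral {0..1::real} (\<lambda>_. 1)"
    unfolding log_kernel_def using * by (intro integral_le i) (auto simp: divide_le_eq)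
  moreover have "0 \<le> log_kernel w"
    unfolding log_kernel_def using * by (intro integral_nonneg i) (force intro: order_trans[OF zero_le_one])
  ultimately show ?thesis by simp
qed

lemma continuous_on_log_kernel: "continuous_on {..0} log_kernel"
  using has_field_derivative_log_kernel
  by (intro continuous_at_imp_continuous_on ballI DERIV_isCont) force

lemma continuous_on_scaled_kernel:
  assumes "continuous_on {..0::real} f" "x \<ge> 0"
  shows "continuous_on {0..1} (\<lambda>s. f (- x * s) :: real)"
  by (rule continuous_on_compose2[OF assms(1)]) (use assms(2) in \<open>auto intro!: continuous_intros\<close>)

text \<open>The index runs one ahead of that of \<open>s_fun\<close>: the target is
  \<open>s_fun n x = 2 * kernel_moment (n + 1) x\<close>.\<close>

definition kernel_moment :: "nat \<Rightarrow> real \<Rightarrow> real" where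
  "kernel_moment n x = arcsine_prod_mean (\<lambda>s. (- x * s) ^ n * log_kernel (- x * s))"

lemma kernel_moment_continuous:
  assumes "x \<ge> 0"
  shows "continuous_on {0..1} (\<lambda>s. (- x * s) ^ n * log_kernel (- x * s))"
  by (intro continuous_on_mult continuous_on_scaled_kernel[OF continuous_on_log_kernel] assms continuous_intros)

lemma arcsine_prod_mean_scaled_power:
  "arcsine_prod_mean (\<lambda>s. (- x * s) ^ n) = (- x) ^ n * legendre_coeff n"
  unfolding power_mult_distrib arcsine_prod_mean_cmult arcsine_prod_mean_power ..

text \<open>Both sides of the integration-by-parts identity in the recurrence below expand to this
  shape, one with exponent \<open>m\<close> and the other with \<open>m + 1\<close>.\<close>

lemma arcsine_prod_mean_kernel_combination:
  assumes "x \<ge> 0"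
  shows "arcsine_prod_mean (\<lambda>s. c0 * ((- x * s) ^ n * log_kernel (- x * s))
      + c1 * ((- x * s) ^ Suc n * log_kernel (- x * s))
      + c2 * ((- x * s) ^ Suc (Suc n) * log_kernel (- x * s))
      + d0 * (- x * s) ^ n + d1 * (- x * s) ^ Suc n)
    = c0 * kernel_moment n x + c1 * kernel_moment (Suc n) x + c2 * kernel_moment (Suc (Suc n)) x
      + d0 * ((- x) ^ n * legendre_coeff n) + d1 * ((- x) ^ Suc n * legendre_coeff (Suc n))"
proof -
  have c: "continuous_on {0..1} (\<lambda>s. a * ((- x * s) ^ n * log_kernel (- x * s)))"
     "continuous_on {0..1} (\<lambda>s. a * (- x * s) ^ n)" for a n
    by (intro continuous_on_mult continuous_on_const kernel_moment_continuous assms)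
       (intro continuous_intros)
  show ?thesis
    unfolding kernel_moment_def
    by (subst arcsine_prod_mean_add arcsine_prod_mean_cmult arcsine_prod_mean_scaled_power
        | intro continuous_on_add c | rule refl)+
qed

text \<open>The Euler operator \<open>\<theta> = w d/dw\<close> maps \<open>w ^ m * (1 - w)\<^sup>2 * log_kernel w\<close> twice to polynomial
  combinations of \<open>1\<close> and \<open>log_kernel\<close>, because \<open>log_kernel_ode\<close> has its only pole at \<open>w = 1\<close>.\<close>

lemma kernel_moment_recurrence:
  assumes "x \<ge> 0"
  defines "W \<equiv> \<lambda>j. (- x) ^ j * legendre_coeff j"
  shows "(real m + 1/2)^2 * kernel_moment (m + 1) x - (2 * real m ^ 2 + 5 * real m + 7/2) * kernel_moment (m + 2) x
      + (real m + 2)^2 * kernel_moment (m + 3) x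
      + (real m + 3/4) * W (m + 1) - (real m + 2) * W (m + 2)
    = - x * (real m ^ 2 * kernel_moment m x - (2 * real m ^ 2 + 3 * real m + 3/2) * kernel_moment (m + 1) x
      + (real m + 3/2)^2 * kernel_moment (m + 2) x
      + (real m + 1/4) * W m - (real m + 3/2) * W (m + 1))"
proof -
  define b b' where "b = log_kernel" and "b' = log_kernel'"
  define M where "M = real m"
  \<comment> \<open>With \<open>w = - x * s\<close>, \<open>k1\<close> and \<open>k2\<close> are
    \<open>\<theta> k0\<close> and \<open>\<theta> k1\<close> after \<open>b'\<close> has been
    eliminated by the differential equation, while \<open>D0\<close> and \<open>D1\<close> are the
    plain derivatives. Each application of \<open>\<theta>\<close> uses up one factor
    \<open>1 - w\<close>; \<open>A\<close> is the coefficient of \<open>b\<close> left after the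
    first.\<close>
  define A where "A = (\<lambda>w. M - 1/2 - (M + 1) * w)"
  define g where "g = (\<lambda>w. A w * b w + 1/2)"
  define k0 where "k0 = (\<lambda>w. w ^ m * (1 - w)^2 * b w)"
  define k1 where "k1 = (\<lambda>w. w ^ m * (1 - w) * g w)"
  define k2 where "k2 = (\<lambda>w. w ^ m * ((M * (1 - w) - w) * g w - (M + 1) * w * (1 - w) * b w + A w * ((w - 1/2) * b w + 1/2)))"
  define D0 where "D0 = (\<lambda>w. M * w ^ (m - 1) * (1 - w)^2 * b w - w ^ m * (2 * (1 - w)) * b w + w ^ m * (1 - w)^2 * b' w)"
  define D1 where "D1 = (\<lambda>w. M * w ^ (m - 1) * (1 - w) * g w - w ^ m * g w + w ^ m * (1 - w) * (A w * b' w - (M + 1) * b w))"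
  \<comment> \<open>At \<open>m = 0\<close> the truncated exponent \<open>m - 1\<close> does no
    harm, since the factor \<open>M\<close> is then zero.\<close>
  have wm: "w * (M * w ^ (m - 1)) = M * w ^ m" for w by (cases m) (auto simp: M_def)
  have db: "(b has_field_derivative b' w) (at w)" if "w \<le> 0" for w
    unfolding b_def b'_def by (rule has_field_derivative_log_kernel) (use that in simp)
  have ode: "w * (1 - w) * b' w = (w - 1/2) * b w + 1/2" if "w \<le> 0" for w
    unfolding b_def b'_def by (rule log_kernel_ode) (use that in simp)
  have d0: "(k0 has_field_derivative D0 w) (at w)" if "w \<le> 0" for w
    unfolding k0_def D0_def
    by (rule derivative_eq_intros db that refl | simp)+ (simp add: M_def algebra_simps)
  have dg: "(g has_field_derivative (A w * b' w - (M + 1) * b w)) (at w)" if "w \<le> 0" for w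
    unfolding g_def A_def
    by (rule derivative_eq_intros db that refl | simp)+ (simp add: algebra_simps)
  have d1: "(k1 has_field_derivative D1 w) (at w)" if "w \<le> 0" for w
    unfolding k1_def D1_def
    by (rule derivative_eq_intros dg that refl | simp)+ (simp add: M_def algebra_simps)
  have e0: "w * D0 w = k1 w" if "w \<le> 0" for w
  proof -
    have "w * D0 w = (w * (M * w ^ (m - 1))) * (1 - w)^2 * b w - w ^ m * (2 * w * (1 - w)) * b w
        + w ^ m * (1 - w) * (w * (1 - w) * b' w)"
      unfolding D0_def by (simp add: power2_eq_square algebra_simps)
    thus ?thesis unfolding wm ode[OF that] k1_def g_def A_def by (simp add: power2_eq_square algebra_simps)
  qed
  have e1: "w * D1 w = k2 w" if "w \<le> 0" for w
  proof -
    have "w * D1 w = (w * (M * w ^ (m - 1))) * (1 - w) * g w - w ^ m * w * g w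
        + w ^ m * (A w * (w * (1 - w) * b' w) - (M + 1) * w * (1 - w) * b w)"
      unfolding D1_def by (simp add: algebra_simps)
    thus ?thesis unfolding wm ode[OF that] k2_def by (simp add: algebra_simps)
  qed
  have cb: "continuous_on {..0} b" unfolding b_def by (rule continuous_on_log_kernel)
  have c: "continuous_on {..0} k0" "continuous_on {..0} k1" "continuous_on {..0} k2"
    unfolding k0_def k1_def k2_def g_def A_def by (intro continuous_intros cb)+
  have chain: "((\<lambda>s. f (- x * s)) has_field_derivative D (- x * s) * - x) (at s)"
    if "\<And>w. w \<le> 0 \<Longrightarrow> (f has_field_derivative D w) (at w)" "s \<in> {0..1}" for f D s
    by (rule DERIV_chain2[where f = f and g = "\<lambda>s. - x * s", OF that(1)])
       (use that(2) assms in \<open>auto intro!: derivative_eq_intros\<close>)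
  have neg: "- x * s \<le> 0" if "s \<in> {0..1}" for s using that assms by auto
  have *: "arcsine_prod_mean (\<lambda>s. k2 (- x * s) + k1 (- x * s) + k0 (- x * s) / 4)
      = arcsine_prod_mean (\<lambda>s. s * (k2 (- x * s) + 2 * k1 (- x * s) + k0 (- x * s)))"
  proof (rule arcsine_prod_mean_by_parts)
    fix s :: real assume s: "s \<in> {0..1}"
    show "((\<lambda>s. k0 (- x * s)) has_field_derivative D0 (- x * s) * - x) (at s)"
      "((\<lambda>s. k1 (- x * s)) has_field_derivative D1 (- x * s) * - x) (at s)"
      by (rule chain[OF _ s], fact d0 d1)+
    show "s * (D0 (- x * s) * - x) = k1 (- x * s)" "s * (D1 (- x * s) * - x) = k2 (- x * s)"
      using e0[OF neg[OF s]] e1[OF neg[OF s]] by (simp_all add: algebra_simps)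
  qed (intro continuous_on_scaled_kernel c assms)+
  \<comment> \<open>The left sides of \<open>P0\<close> and \<open>P1\<close> are
    \<open>(\<theta> + 1/2)^2 k0\<close> and \<open>w (\<theta> + 1)^2 k0\<close>.\<close>
  have P0: "k2 w + k1 w + k0 w / 4 = M^2 * (w ^ m * b w) + (- (2 * M^2 + 3 * M + 3/2)) * (w ^ Suc m * b w)
      + (M + 3/2)^2 * (w ^ Suc (Suc m) * b w) + (M + 1/4) * w ^ m + (- (M + 3/2)) * w ^ Suc m" for w
    unfolding k0_def k1_def k2_def g_def A_def by (simp add: power2_eq_square field_simps)
  have P1: "w * (k2 w + 2 * k1 w + k0 w) = (M + 1/2)^2 * (w ^ (m + 1) * b w)
      + (- (2 * M^2 + 5 * M + 7/2)) * (w ^ Suc (m + 1) * b w)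
      + (M + 2)^2 * (w ^ Suc (Suc (m + 1)) * b w) + (M + 3/4) * w ^ (m + 1) + (- (M + 2)) * w ^ Suc (m + 1)" for w
    unfolding k0_def k1_def k2_def g_def A_def by (simp add: power2_eq_square field_simps)
  \<comment> \<open>Multiplying by \<open>- x\<close> turns the extra factor \<open>s\<close> into
    \<open>w = - x * s\<close>, so that the right side is again a mean of a function of
    \<open>w\<close>.\<close>
  have "- x * arcsine_prod_mean (\<lambda>s. k2 (- x * s) + k1 (- x * s) + k0 (- x * s) / 4)
      = arcsine_prod_mean (\<lambda>s. - x * s * (k2 (- x * s) + 2 * k1 (- x * s) + k0 (- x * s)))"
    unfolding * arcsine_prod_mean_cmult[symmetric] by (simp add: mult.assoc)
  thus ?thesis
    unfolding P0 P1 b_def W_def M_def arcsine_prod_mean_kernel_combination[OF assms(1)]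
    by (simp add: numeral_3_eq_3 numeral_2_eq_2 algebra_simps)
qed

section \<open>Differential equations for the first two moments\<close>

lemma continuous_on_log_kernel': "continuous_on {..0} log_kernel'"
proof -
  have "continuous_on ({..0} \<times> cbox 0 1) (\<lambda>y. (1 - (snd y)\<^sup>2) / (1 - (fst y) * (1 - (snd y)\<^sup>2))\<^sup>2 :: real)"
    by (intro continuous_intros ballI) (use log_kernel_denom_pos in \<open>force dest: less_imp_neq[symmetric]\<close>)
  hence "continuous_on ({..0} \<times> cbox 0 1) (\<lambda>(w, u). (1 - u\<^sup>2) / (1 - w * (1 - u\<^sup>2))\<^sup>2 :: real)"
    by (simp add: case_prod_unfold)
  from integral_continuous_on_param[OF this] show ?thesis
    by (simp add: log_kernel'_def[abs_def])
qed

text \<open>The two means are differentiated one after the other on the open half-line, where the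
  derivative within the set is the ordinary one and \<open>f\<close> is sampled only at nonpositive
  arguments.\<close>

lemma has_field_derivative_scaled_mean:
  fixes f D :: "real \<Rightarrow> real"
  assumes x: "x > 0" and D: "\<And>w. w \<le> 0 \<Longrightarrow> (f has_field_derivative D w) (at w)"
    and c: "continuous_on {..0} D"
  shows "((\<lambda>x. arcsine_prod_mean (\<lambda>s. f (- x * s))) has_field_derivative
      arcsine_prod_mean (\<lambda>s. - s * D (- x * s))) (at x)"
proof -
  let ?U = "{0<..} :: real set"
  have cf: "continuous_on {..0} f"
    by (intro continuous_at_imp_continuous_on ballI DERIV_isCont[OF D]) simp
  have nn: "0 \<le> y * (s * t)" if "y \<in> ?U" "s \<in> {0..1}" "t \<in> {0..1}" for y s t :: real
    using that by simp
  have inner: "((\<lambda>x. arcsine_mean (\<lambda>t. f (- x * (s * t)))) has_field_derivative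
      arcsine_mean (\<lambda>t. - (s * t) * D (- y * (s * t)))) (at y within ?U)"
    if s: "s \<in> {0..1}" and y: "y \<in> ?U" for s y
  proof (rule has_field_derivative_arcsine_mean)
    fix y t :: real assume *: "y \<in> ?U" "t \<in> {0..1}"
    have "((\<lambda>x. f (- x * (s * t))) has_field_derivative D (- y * (s * t)) * - (s * t)) (at y within ?U)"
      by (rule DERIV_chain2[where f = f and g = "\<lambda>x. - x * (s * t)", OF D])
         (use * s in \<open>auto intro!: derivative_eq_intros\<close>)
    thus "((\<lambda>x. f (- x * (s * t))) has_field_derivative - (s * t) * D (- y * (s * t))) (at y within ?U)"
      by (simp add: mult.commute)
  next
    fix y :: real assume "y \<in> ?U"
    thus "continuous_on {0..1} (\<lambda>t. f (- y * (s * t)))"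
      by (intro continuous_on_compose2[OF cf]) (use s in \<open>auto intro!: continuous_intros\<close>)
  next
    have "continuous_on (?U \<times> {0..1}) (\<lambda>y. - (s * snd y) * D (- fst y * (s * snd y)))"
      by (intro continuous_on_mult continuous_on_compose2[OF c]) (use s in \<open>auto intro!: continuous_intros\<close>)
    thus "continuous_on (?U \<times> {0..1}) (\<lambda>(y, t). - (s * t) * D (- y * (s * t)))"
      by (simp add: case_prod_unfold)
  qed (use y in auto)
  have "((\<lambda>x. arcsine_mean (\<lambda>s. arcsine_mean (\<lambda>t. f (- x * (s * t))))) has_field_derivative
      arcsine_mean (\<lambda>s. arcsine_mean (\<lambda>t. - (s * t) * D (- x * (s * t))))) (at x within ?U)"
  proof (rule has_field_derivative_arcsine_mean[OF inner])
    fix y :: real assume "y \<in> ?U"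
    hence "continuous_on {0..1} (\<lambda>s. f (- y * s))" by (intro continuous_on_scaled_kernel cf) auto
    thus "continuous_on {0..1} (\<lambda>s. arcsine_mean (\<lambda>t. f (- y * (s * t))))"
      by (rule continuous_on_inner_mean)
  next
    have "continuous_on ((?U \<times> {0..1}) \<times> {0..1})
        (\<lambda>y. - (snd (fst y) * snd y) * D (- fst (fst y) * (snd (fst y) * snd y)))"
      by (intro continuous_on_mult continuous_on_compose2[OF c]) (auto intro!: continuous_intros)
    hence "continuous_on ((?U \<times> {0..1}) \<times> {0..1})
        (\<lambda>(y, t). - (snd y * t) * D (- fst y * (snd y * t)))"
      by (simp add: case_prod_unfold)
    from continuous_on_arcsine_mean[OF this]
    show "continuous_on (?U \<times> {0..1}) (\<lambda>(y, s). arcsine_mean (\<lambda>t. - (s * t) * D (- y * (s * t))))"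
      by (simp add: case_prod_unfold)
  qed (use x in auto)
  thus ?thesis using x unfolding arcsine_prod_mean_def by (simp add: at_within_open[of _ ?U])
qed

text \<open>Let \<open>b = log_kernel\<close> and let \<open>I\<close> be the mean of
  \<open>(\<theta> + 1/2) b\<close>. By parts, \<open>- z * I\<close> is the mean of
  \<open>w (\<theta> + 1) b\<close>, which the differential equation identifies with
  \<open>(\<theta> + 1/2) b - 1/2\<close>. Hence \<open>- z * I = I - 1/2\<close>.\<close>

lemma arcsine_mean_log_kernel:
  assumes "z \<ge> 0"
  shows "arcsine_mean (\<lambda>t. - z * t * log_kernel' (- z * t) + log_kernel (- z * t) / 2) = 1 / (2 * (1 + z))"
proof -
  define q q1 where "q = (\<lambda>t. log_kernel (- z * t))" and "q1 = (\<lambda>t. - z * t * log_kernel' (- z * t))"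
  have c: "continuous_on {0..1} q" "continuous_on {0..1} q1"
    unfolding q_def q1_def
    by (intro continuous_on_mult continuous_intros continuous_on_scaled_kernel[OF _ assms]
        continuous_on_log_kernel continuous_on_log_kernel')+
  have *: "arcsine_mean (\<lambda>t. q1 t + q t / 2) = arcsine_mean (\<lambda>t. t * (q1 t + q t))"
  proof (rule arcsine_mean_by_parts[OF c])
    fix t :: real assume t: "t \<in> {0..1}"
    have "- z * t < 1" using mult_nonneg_nonneg[OF assms, of t] t by simp
    from has_field_derivative_log_kernel[OF this]
    show "(q has_field_derivative log_kernel' (- z * t) * - z) (at t)"
      unfolding q_def by (rule DERIV_chain2[where f = log_kernel and g = "\<lambda>t. - z * t"]) (auto intro!: derivative_eq_intros)
    show "t * (log_kernel' (- z * t) * - z) = q1 t" by (simp add: q1_def)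
  qed
  have "- z * arcsine_mean (\<lambda>t. q1 t + q t / 2) = arcsine_mean (\<lambda>t. - z * t * (q1 t + q t))"
    unfolding * arcsine_mean_cmult[symmetric] by (simp add: mult.assoc)
  also have "\<dots> = arcsine_mean (\<lambda>t. (q1 t + q t / 2) + (- 1/2))"
  proof (rule arcsine_mean_cong)
    fix t :: real assume t: "t \<in> {0..1}"
    have "- z * t < 1" using mult_nonneg_nonneg[OF assms, of t] t by simp
    from log_kernel_ode[OF this]
    show "- z * t * (q1 t + q t) = (q1 t + q t / 2) + (- 1/2)"
      unfolding q_def q1_def by (simp add: algebra_simps)
  qed
  also have "\<dots> = arcsine_mean (\<lambda>t. q1 t + q t / 2) - 1/2"
    by (subst arcsine_mean_add) (auto intro!: continuous_intros c)
  finally have "(1 + z) * arcsine_mean (\<lambda>t. q1 t + q t / 2) = 1/2" by (simp add: algebra_simps)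
  thus ?thesis using assms unfolding q_def q1_def by (simp add: field_simps)
qed

text \<open>The inner mean is a Cauchy kernel by the preceding lemma, and the outer mean turns it
  into an inverse square root.\<close>

lemma arcsine_prod_mean_log_kernel:
  assumes "x \<ge> 0"
  shows "arcsine_prod_mean (\<lambda>s. - x * s * log_kernel' (- x * s) + log_kernel (- x * s) / 2)
      = 1 / (2 * sqrt (1 + x))"
proof -
  have "arcsine_prod_mean (\<lambda>s. - x * s * log_kernel' (- x * s) + log_kernel (- x * s) / 2)
      = arcsine_mean (\<lambda>s. 1/2 * (1 / (1 + x * s)))"
    unfolding arcsine_prod_mean_def
  proof (rule arcsine_mean_cong)
    fix s :: real assume "s \<in> {0..1}"
    thus "arcsine_mean (\<lambda>t. - x * (s * t) * log_kernel' (- x * (s * t)) + log_kernel (- x * (s * t)) / 2)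
      = 1/2 * (1 / (1 + x * s))"
      using arcsine_mean_log_kernel[of "x * s"] assms by (simp add: mult.assoc)
  qed
  thus ?thesis
    unfolding arcsine_mean_cmult arcsine_mean_cauchy_kernel[OF assms] by simp
qed

text \<open>This supplies the behaviour at \<open>0\<close> that fixes the constants of integration
  in the formulas for the first two moments.\<close>

lemma kernel_moment_bounded:
  assumes "x \<ge> 0"
  shows "\<bar>kernel_moment n x\<bar> \<le> x ^ n"
proof -
  have *: "\<bar>(- x * s) ^ n * log_kernel (- x * s)\<bar> \<le> x ^ n" if "s \<in> {0..1}" for s
  proof -
    have "\<bar>(- x * s) ^ n * log_kernel (- x * s)\<bar> = (x * s) ^ n * log_kernel (- x * s)"
      using log_kernel_bounds[of "- x * s"] assms that by (simp add: abs_mult power_abs)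
    also have "\<dots> \<le> x ^ n * 1"
      using log_kernel_bounds[of "- x * s"] assms that
      by (intro mult_mono power_mono) (auto intro: mult_left_le)
    finally show ?thesis by simp
  qed
  hence **: "(- x * s) ^ n * log_kernel (- x * s) \<le> x ^ n" "- (x ^ n) \<le> (- x * s) ^ n * log_kernel (- x * s)"
    if "s \<in> {0..1}" for s using that by (auto simp only: abs_le_iff minus_le_iff)
  have "kernel_moment n x \<le> arcsine_prod_mean (\<lambda>_. x ^ n)"
    unfolding kernel_moment_def
    by (intro arcsine_prod_mean_mono kernel_moment_continuous assms continuous_intros **)
  moreover have "arcsine_prod_mean (\<lambda>_. - (x ^ n)) \<le> kernel_moment n x"
    unfolding kernel_moment_def
    by (intro arcsine_prod_mean_mono kernel_moment_continuous assms continuous_intros **)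
  ultimately show ?thesis by (simp add: abs_le_iff)
qed

text \<open>The initial condition is a one-sided limit because one of the applications is to a
  quotient by \<open>x\<close>.\<close>

lemma zero_if_derivative_zero_and_limit_zero:
  fixes f :: "real \<Rightarrow> real"
  assumes D: "\<And>x. x > 0 \<Longrightarrow> (f has_field_derivative 0) (at x)" and lim: "(f \<longlongrightarrow> 0) (at_right 0)"
    and "x > 0"
  shows "f x = 0"
proof -
  have "\<exists>c. \<forall>y\<in>{0<..}. f y = c"
    by (rule has_field_derivative_zero_constant) (auto intro: has_field_derivative_at_within[OF D])
  then obtain c where c: "\<And>y. y > 0 \<Longrightarrow> f y = c" by auto
  have "eventually (\<lambda>y. f y = c) (at_right 0)"
    using eventually_at_right_less[of 0] by eventually_elim (rule c)
  with lim have "((\<lambda>_. c) \<longlongrightarrow> 0) (at_right (0::real))" by (rule Lim_transform_eventually)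
  hence "c = 0" by (simp add: tendsto_const_iff)
  thus ?thesis using c assms(3) by simp
qed

text \<open>On functions of \<open>w = - x * s\<close> the operator \<open>x d/dx\<close> acts as
  \<open>\<theta>\<close>. By \<open>log_kernel_ode\<close>,
  \<open>\<theta> (w b) = (\<theta> + 1/2) b - 1/2\<close> for \<open>b = log_kernel\<close>, and
  the mean of the right side is known.\<close>

lemma has_field_derivative_kernel_moment_1:
  assumes "x > 0"
  shows "(kernel_moment 1 has_field_derivative (1 / (2 * sqrt (1 + x)) - 1/2) / x) (at x)"
proof -
  let ?D = "\<lambda>w. log_kernel w + w * log_kernel' w"
  have 1: "((\<lambda>x. arcsine_prod_mean (\<lambda>s. (- x * s) * log_kernel (- x * s))) has_field_derivative
      arcsine_prod_mean (\<lambda>s. - s * ?D (- x * s))) (at x)"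
  proof (rule has_field_derivative_scaled_mean[OF assms])
    fix w :: real assume "w \<le> 0"
    hence "w < 1" by simp
    thus "((\<lambda>w. w * log_kernel w) has_field_derivative ?D w) (at w)"
      by (auto intro!: derivative_eq_intros has_field_derivative_log_kernel)
  qed (intro continuous_intros continuous_on_log_kernel continuous_on_log_kernel')
  let ?k = "\<lambda>s. - x * s * log_kernel' (- x * s) + log_kernel (- x * s) / 2"
  have div: "A = E / x" if "x * A = E" for A E using that assms by auto
  have "x * arcsine_prod_mean (\<lambda>s. - s * ?D (- x * s)) = arcsine_prod_mean (\<lambda>s. - x * s * ?D (- x * s))"
    unfolding arcsine_prod_mean_cmult[symmetric] by (simp add: mult.assoc)
  also have "\<dots> = arcsine_prod_mean (\<lambda>s. ?k s + (- 1/2))"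
  proof (rule arcsine_prod_mean_cong)
    fix s :: real assume "s \<in> {0..1}"
    hence "- x * s < 1" using mult_nonneg_nonneg[of x s] assms by (simp del: mult_nonneg_nonneg)
    from log_kernel_ode[OF this]
    show "- x * s * ?D (- x * s) = ?k s + (- 1/2)" by (simp add: algebra_simps)
  qed
  also have "\<dots> = 1 / (2 * sqrt (1 + x)) - 1/2"
  proof (subst arcsine_prod_mean_add)
    show "continuous_on {0..1} ?k"
      using assms by (intro continuous_on_add continuous_on_mult continuous_intros
        continuous_on_scaled_kernel[OF continuous_on_log_kernel] continuous_on_scaled_kernel[OF continuous_on_log_kernel']) auto
  qed (use assms arcsine_prod_mean_log_kernel[of x] in auto)
  finally have "arcsine_prod_mean (\<lambda>s. - s * ?D (- x * s)) = (1 / (2 * sqrt (1 + x)) - 1/2) / x"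
    by (rule div)
  with 1 show ?thesis by (simp only: kernel_moment_def[abs_def] power_one_right)
qed

lemma has_field_derivative_sqrt_Suc:
  assumes "x > 0"
  shows "((\<lambda>x. sqrt (1 + x)) has_field_derivative 1 / (2 * sqrt (1 + x))) (at x)"
proof -
  have pos: "0 < 1 + x" using assms by simp
  have "((\<lambda>x. 1 + x) has_field_derivative (0 + 1)) (at x)"
    by (intro DERIV_add DERIV_const DERIV_ident)
  hence "((\<lambda>x. sqrt (1 + x)) has_field_derivative (inverse (sqrt (1 + x)) / 2) * (0 + 1)) (at x)"
    by (rule DERIV_chain2[where f = sqrt and g = "\<lambda>x. 1 + x", OF DERIV_real_sqrt[OF pos]])
  thus ?thesis by (simp add: field_simps)
qed

lemma has_field_derivative_ln_half_sqrt:
  assumes "x > 0"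
  shows "((\<lambda>x. ln ((1 + sqrt (1 + x)) / 2)) has_field_derivative 1 / (2 * sqrt (1 + x) * (1 + sqrt (1 + x)))) (at x)"
proof -
  define r where "r = sqrt (1 + x)"
  have r: "r > 0" using assms by (simp add: r_def)
  have "((\<lambda>x. ln ((1 + sqrt (1 + x)) / 2)) has_field_derivative
      1 / ((1 + sqrt (1 + x)) / 2) * ((0 + 1 / (2 * sqrt (1 + x))) / 2)) (at x)"
  proof (rule DERIV_chain2[where f = ln and g = "\<lambda>x. (1 + sqrt (1 + x)) / 2"])
    show "(ln has_field_derivative 1 / ((1 + sqrt (1 + x)) / 2)) (at ((1 + sqrt (1 + x)) / 2))"
      using r unfolding r_def by (intro DERIV_ln_divide half_gt_zero add_pos_pos zero_less_one)
  qed (intro DERIV_cdivide DERIV_add DERIV_const has_field_derivative_sqrt_Suc assms)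
  also have "1 / ((1 + sqrt (1 + x)) / 2) * ((0 + 1 / (2 * sqrt (1 + x))) / 2) = 1 / (2 * sqrt (1 + x) * (1 + sqrt (1 + x)))"
    unfolding r_def[symmetric] using r by (simp add: divide_simps)
  finally show ?thesis .
qed

lemma kernel_moment_1:
  assumes "x > 0"
  shows "2 * kernel_moment 1 x = s_fun 0 x"
proof -
  have "2 * kernel_moment 1 x - s_fun 0 x = 0"
  proof (rule zero_if_derivative_zero_and_limit_zero[OF _ _ assms])
    fix x :: real assume x: "x > 0"
    define r where "r = sqrt (1 + x)"
    have r: "r > 0" "x = r^2 - 1" "r \<noteq> 1" using x by (auto simp: r_def)
    have "(s_fun 0 has_field_derivative - 2 * (1 / (2 * r * (1 + r)))) (at x)"
      unfolding s_fun.simps[abs_def] r_def by (intro DERIV_cmult has_field_derivative_ln_half_sqrt x)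
    also have "- 2 * (1 / (2 * r * (1 + r))) = 2 * ((1 / (2 * r) - 1/2) / x)"
      using r(1,3) x unfolding r(2) by (simp add: divide_simps) (simp add: power2_eq_square algebra_simps)
    finally have "((\<lambda>x. 2 * kernel_moment 1 x - s_fun 0 x) has_field_derivative
        2 * ((1 / (2 * r) - 1/2) / x) - 2 * ((1 / (2 * r) - 1/2) / x)) (at x)"
      unfolding r_def by (intro DERIV_diff DERIV_cmult has_field_derivative_kernel_moment_1 x)
    thus "((\<lambda>x. 2 * kernel_moment 1 x - s_fun 0 x) has_field_derivative 0) (at x)" by simp
  next
    have "(kernel_moment 1 \<longlongrightarrow> 0) (at_right 0)"
    proof (rule Lim_null_comparison)
      show "\<forall>\<^sub>F x in at_right 0. norm (kernel_moment 1 x) \<le> x"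
        using eventually_at_right_less[of "0::real"]
        by eventually_elim (use kernel_moment_bounded[of _ 1] in simp)
    qed (intro tendsto_intros)
    moreover have "(s_fun 0 \<longlongrightarrow> 0) (at_right 0)"
      unfolding s_fun.simps[abs_def] by real_asymp
    ultimately show "((\<lambda>x. 2 * kernel_moment 1 x - s_fun 0 x) \<longlongrightarrow> 0) (at_right 0)"
      by (auto intro!: tendsto_eq_intros)
  qed
  thus ?thesis by simp
qed

text \<open>The same method applied to \<open>w^2 b\<close> leaves, besides the known mean of
  \<open>(\<theta> + 1/2) b\<close>, the first two moments, and so a first-order equation for the
  second.\<close>

lemma has_field_derivative_kernel_moment_2:
  assumes "x > 0"
  shows "(kernel_moment 2 has_field_derivative
      (kernel_moment 2 x + (1 / sqrt (1 + x) - 1) / 2 - kernel_moment 1 x / 2 + x / 8) / x) (at x)"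
proof -
  let ?D = "\<lambda>w. 2 * w * log_kernel w + w\<^sup>2 * log_kernel' w"
  have 1: "((\<lambda>x. arcsine_prod_mean (\<lambda>s. (- x * s)\<^sup>2 * log_kernel (- x * s))) has_field_derivative
      arcsine_prod_mean (\<lambda>s. - s * ?D (- x * s))) (at x)"
  proof (rule has_field_derivative_scaled_mean[OF assms])
    fix w :: real assume "w \<le> 0"
    hence "w < 1" by simp
    thus "((\<lambda>w. w\<^sup>2 * log_kernel w) has_field_derivative ?D w) (at w)"
      by (auto intro!: derivative_eq_intros has_field_derivative_log_kernel)
  qed (intro continuous_intros continuous_on_log_kernel continuous_on_log_kernel')
  let ?k = "\<lambda>s. - x * s * log_kernel' (- x * s) + log_kernel (- x * s) / 2"
  have div: "A = E / x" if "x * A = E" for A E using that assms by auto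
  have x0: "x \<ge> 0" using assms by simp
  have c1: "continuous_on {0..1} ?k"
    by (intro continuous_on_add continuous_on_mult continuous_intros x0
        continuous_on_scaled_kernel[OF continuous_on_log_kernel] continuous_on_scaled_kernel[OF continuous_on_log_kernel']) simp
  have c2: "continuous_on {0..1} (\<lambda>s. c * ((- x * s) ^ n * log_kernel (- x * s)))" for c n
    by (rule continuous_on_mult[OF continuous_on_const kernel_moment_continuous[OF x0]])
  have c3: "continuous_on {0..1} (\<lambda>s. c * (- x * s) ^ n)" for c n
    by (intro continuous_intros)
  have "x * arcsine_prod_mean (\<lambda>s. - s * ?D (- x * s)) = arcsine_prod_mean (\<lambda>s. - x * s * ?D (- x * s))"
    unfolding arcsine_prod_mean_cmult[symmetric] by (simp add: mult.assoc)
  also have "\<dots> = arcsine_prod_mean (\<lambda>s. 1 * ((- x * s)^2 * log_kernel (- x * s))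
      + ?k s + (- 1/2) * (- x * s)^0 + (- 1/2) * ((- x * s)^1 * log_kernel (- x * s)) + (- 1/2) * (- x * s)^1)"
  proof (rule arcsine_prod_mean_cong)
    fix s :: real assume "s \<in> {0..1}"
    hence "- x * s < 1" using mult_nonneg_nonneg[of x s] assms by (simp del: mult_nonneg_nonneg)
    note ode = log_kernel_ode[OF this]
    \<comment> \<open>The differential equation is added to \<open>w\<close> times itself, which
      cancels the term \<open>w^2 b'\<close> and leaves \<open>w^3 b'\<close> on one side and
      \<open>w b'\<close> on the other.\<close>
    have alg: "w * (2 * w * b + w\<^sup>2 * b') = 1 * (w^2 * b) + (w * b' + b / 2) + (- 1/2) * w^0 + (- 1/2) * (w^1 * b) + (- 1/2) * w^1"
      if "w * (1 - w) * b' = (w - 1/2) * b + 1/2" for w b b' :: real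
    proof -
      have "w * (w * (1 - w) * b') + w * (1 - w) * b' = w * ((w - 1/2) * b + 1/2) + ((w - 1/2) * b + 1/2)"
        unfolding that ..
      thus ?thesis by (simp add: power2_eq_square algebra_simps)
    qed
    show "- x * s * ?D (- x * s) = 1 * ((- x * s)^2 * log_kernel (- x * s))
      + ?k s + (- 1/2) * (- x * s)^0 + (- 1/2) * ((- x * s)^1 * log_kernel (- x * s)) + (- 1/2) * (- x * s)^1"
      by (rule alg[OF ode])
  qed
  also have "\<dots> = kernel_moment 2 x + (1 / sqrt (1 + x) - 1) / 2 - kernel_moment 1 x / 2 + x / 8"
  proof -
    have add5: "arcsine_prod_mean (\<lambda>s. f1 s + f2 s + f3 s + f4 s + f5 s)
      = arcsine_prod_mean f1 + arcsine_prod_mean f2 + arcsine_prod_mean f3 + arcsine_prod_mean f4 + arcsine_prod_mean f5"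
      if "continuous_on {0..1} f1" "continuous_on {0..1} f2" "continuous_on {0..1} f3"
        "continuous_on {0..1} f4" "continuous_on {0..1} f5" for f1 f2 f3 f4 f5
      using that by (simp add: arcsine_prod_mean_add continuous_on_add)
    show ?thesis
      unfolding add5[OF c2 c1 c3 c2 c3] arcsine_prod_mean_cmult arcsine_prod_mean_scaled_power
        arcsine_prod_mean_log_kernel[OF less_imp_le[OF assms]] kernel_moment_def[symmetric]
      by (simp add: legendre_coeff_Suc power2_eq_square diff_divide_distrib)
  qed
  finally have "arcsine_prod_mean (\<lambda>s. - s * ?D (- x * s))
      = (kernel_moment 2 x + (1 / sqrt (1 + x) - 1) / 2 - kernel_moment 1 x / 2 + x / 8) / x"
    by (rule div)
  with 1 show ?thesis by (simp only: kernel_moment_def[abs_def])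
qed

text \<open>Both sides satisfy \<open>x y' = y + h\<close> with the same \<open>h\<close>, so their
  difference divided by \<open>x\<close> is constant. The limit at \<open>0\<close> makes the
  constant zero, as the moment is \<open>O(x^2)\<close> and \<open>s_fun 1 x\<close> is
  \<open>o(x)\<close>.\<close>

lemma kernel_moment_2:
  assumes "x > 0"
  shows "2 * kernel_moment 2 x = s_fun 1 x"
proof -
  have "(2 * kernel_moment 2 x - s_fun 1 x) / x = 0"
  proof (rule zero_if_derivative_zero_and_limit_zero[OF _ _ assms])
    fix x :: real assume x: "x > 0"
    define r L where "r = sqrt (1 + x)" and "L = ln ((1 + r) / 2)"
    have r: "r > 0" "x = r^2 - 1" "r \<noteq> 1" using x by (auto simp: r_def)
    have "(s_fun 1 has_field_derivative (1/2 * L + 1 / (2 * r * (1 + r)) * (x / 2 - 1))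
        - 1/2 * (1 / (2 * r)) + 0 + 1/2) (at x)"
      unfolding One_nat_def s_fun.simps[abs_def] r_def L_def
      by (intro DERIV_add DERIV_diff DERIV_mult DERIV_cmult DERIV_const DERIV_cdivide
            has_field_derivative_ln_half_sqrt has_field_derivative_sqrt_Suc x DERIV_cong[OF DERIV_diff[OF DERIV_cdivide[OF DERIV_ident] DERIV_const]] DERIV_ident) simp
    also have "(1/2 * L + 1 / (2 * r * (1 + r)) * (x / 2 - 1)) - 1/2 * (1 / (2 * r)) + 0 + 1/2
        = (s_fun 1 x + 1 / r - 1 + L + x / 4) / x"
      unfolding One_nat_def s_fun.simps r_def[symmetric] L_def[symmetric]
      using r(1,3) x unfolding r(2) by (simp add: divide_simps) (simp add: power2_eq_square algebra_simps)
    finally have s: "(s_fun 1 has_field_derivative (s_fun 1 x + 1 / r - 1 + L + x / 4) / x) (at x)" .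
    have k: "kernel_moment 1 x = - L"
      using kernel_moment_1[OF x] by (simp add: L_def r_def)
    have "((\<lambda>x. 2 * kernel_moment 2 x - s_fun 1 x) has_field_derivative
        2 * ((kernel_moment 2 x + (1 / r - 1) / 2 - kernel_moment 1 x / 2 + x / 8) / x)
          - (s_fun 1 x + 1 / r - 1 + L + x / 4) / x) (at x)"
      by (intro DERIV_diff DERIV_cmult has_field_derivative_kernel_moment_2[OF x, folded r_def] s)
    also have "2 * ((kernel_moment 2 x + (1 / r - 1) / 2 - kernel_moment 1 x / 2 + x / 8) / x)
          - (s_fun 1 x + 1 / r - 1 + L + x / 4) / x = (2 * kernel_moment 2 x - s_fun 1 x) / x"
      unfolding k using x r(1) by (simp add: divide_simps) (simp add: algebra_simps)
    finally have "((\<lambda>x. (2 * kernel_moment 2 x - s_fun 1 x) / x) has_field_derivative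
        ((2 * kernel_moment 2 x - s_fun 1 x) / x * x - (2 * kernel_moment 2 x - s_fun 1 x) * 1) / (x * x)) (at x)"
      using x by (intro DERIV_divide DERIV_ident) auto
    thus "((\<lambda>x. (2 * kernel_moment 2 x - s_fun 1 x) / x) has_field_derivative 0) (at x)"
      using x by simp
  next
    have "((\<lambda>x. kernel_moment 2 x / x) \<longlongrightarrow> 0) (at_right 0)"
    proof (rule Lim_null_comparison)
      show "\<forall>\<^sub>F x in at_right 0. norm (kernel_moment 2 x / x) \<le> x"
        using eventually_at_right_less[of "0::real"]
        by eventually_elim (use kernel_moment_bounded[of _ 2] in \<open>simp add: abs_divide divide_le_eq power2_eq_square\<close>)
    qed (intro tendsto_intros)
    moreover have "((\<lambda>x. s_fun 1 x / x) \<longlongrightarrow> 0) (at_right 0)"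
      unfolding One_nat_def s_fun.simps[abs_def] by real_asymp
    ultimately have "((\<lambda>x. 2 * (kernel_moment 2 x / x) - s_fun 1 x / x) \<longlongrightarrow> 2 * 0 - 0) (at_right 0)"
      by (intro tendsto_intros)
    thus "((\<lambda>x. (2 * kernel_moment 2 x - s_fun 1 x) / x) \<longlongrightarrow> 0) (at_right 0)"
      by (simp add: diff_divide_distrib)
  qed
  thus ?thesis using assms by simp
qed

section \<open>Identification of \<open>s_fun\<close> with the moments\<close>

text \<open>The right side is \<open>8\<close> times what the polynomial terms of
  \<open>kernel_moment_recurrence\<close> at \<open>m = n + 1\<close> contribute when it is solved
  for its highest moment.\<close>

lemma coeff_h_legendre_coeff:
  "coeff_h n x = (- x) ^ (n + 2) * (4 * (2 * real n + 5/2) * legendre_coeff (n + 1) - 4 * (2 * real n + 7/2) * legendre_coeff (n + 2))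
     + (- x) ^ (n + 3) * (4 * (2 * real n + 6) * legendre_coeff (n + 3) - 4 * (2 * real n + 5) * legendre_coeff (n + 2))"
proof -
  define P F where "P = (pochhammer (3/2) n :: real)^2" and "F = (fact n :: real)^2"
  define M where "M = real n"
  have F: "F > 0" by (simp add: F_def)
  have M: "M \<ge> 0" by (simp add: M_def)
  have p: "pochhammer (1/2) (n + 1) = 1/2 * pochhammer (3/2 :: real) n"
    by (simp add: pochhammer_rec)
  have 1: "legendre_coeff (n + 1) = P / (4 * (M + 1)^2 * F)"
    unfolding legendre_coeff_def p
    by (simp add: P_def F_def M_def power_mult_distrib power_divide add.commute)
  have 2: "legendre_coeff (n + 2) = ((M + 3/2) / (M + 2))^2 * (P / (4 * (M + 1)^2 * F))"
    using legendre_coeff_Suc[of "n + 1"] unfolding 1 by (simp add: M_def add_ac)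
  have 3: "legendre_coeff (n + 3) = ((M + 5/2) / (M + 3))^2 * (((M + 3/2) / (M + 2))^2 * (P / (4 * (M + 1)^2 * F)))"
    using legendre_coeff_Suc[of "n + 2"] unfolding 2 by (simp add: M_def add_ac numeral_3_eq_3)
  have f: "(fact (n + 2) :: real)^2 = ((M + 2) * (M + 1))^2 * F"
    by (simp add: F_def M_def power_mult_distrib numeral_2_eq_2 algebra_simps)
  have h: "coeff_h n x = (x * (2 * M + 5) * (2 * M + 3)^2 + (M + 3) * (8 * M^2 + 24 * M + 17))
     / (8 * (M + 3) * (((M + 2) * (M + 1))^2 * F)) * P * (- x) ^ (n + 2)"
    unfolding coeff_h_def f P_def M_def ..
  \<comment> \<open>The powers \<open>(- x) ^ (n + 2)\<close> and \<open>(- x) ^ (n + 3)\<close> are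
    matched separately in \<open>A\<close> and \<open>B\<close>; the sign in \<open>B\<close> comes
    from absorbing the factor \<open>x\<close> of \<open>coeff_h\<close> into a power of
    \<open>- x\<close>.\<close>
  have A: "4 * (2 * M + 5/2) * (P / (4 * (M + 1)^2 * F)) - 4 * (2 * M + 7/2) * (((M + 3/2) / (M + 2))^2 * (P / (4 * (M + 1)^2 * F)))
    = (8 * M^2 + 24 * M + 17) / (8 * ((M + 2) * (M + 1))^2 * F) * P"
    using F M by (simp add: divide_simps) (simp add: power2_eq_square algebra_simps)
  have B: "4 * (2 * M + 6) * (((M + 5/2) / (M + 3))^2 * (((M + 3/2) / (M + 2))^2 * (P / (4 * (M + 1)^2 * F))))
      - 4 * (2 * M + 5) * (((M + 3/2) / (M + 2))^2 * (P / (4 * (M + 1)^2 * F)))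
    = - ((2 * M + 5) * (2 * M + 3)^2 / (8 * (M + 3) * ((M + 2) * (M + 1))^2 * F) * P)"
    using F M by (simp add: divide_simps) (simp add: power2_eq_square algebra_simps)
  have "coeff_h n x = (- x) ^ (n + 2) * ((8 * M^2 + 24 * M + 17) / (8 * ((M + 2) * (M + 1))^2 * F) * P)
     + (- x) ^ (n + 3) * - ((2 * M + 5) * (2 * M + 3)^2 / (8 * (M + 3) * ((M + 2) * (M + 1))^2 * F) * P)"
    unfolding h power_add[of "- x" n] using F M by (simp add: divide_simps) (simp add: power2_eq_square power3_eq_cube algebra_simps)
  thus ?thesis unfolding 1 2 3 A B M_def[symmetric] .
qed

text \<open>The induction follows the defining equations of \<open>s_fun\<close>: the first two
  cases come from the differential equations, the third from the moment recurrence at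
  \<open>m = 0\<close>, and the last from the recurrence at \<open>m = n + 1\<close>.\<close>

lemma s_fun_eq_kernel_moment:
  assumes "x > 0"
  shows "s_fun n x = 2 * kernel_moment (n + 1) x"
  using assms
proof (induction n x rule: s_fun.induct)
  case (1 x)
  thus ?case using kernel_moment_1 by simp
next
  case (2 x)
  thus ?case using kernel_moment_2 by (simp add: numeral_2_eq_2)
next
  case (3 x)
  define k where "k = kernel_moment"
  define r L where "r = sqrt (1 + x)" and "L = ln ((1 + r) / 2)"
  have k1: "k 1 x = - L"
    using kernel_moment_1[OF 3] by (simp add: k_def L_def r_def)
  have k2: "k 2 x = ((x / 2 - 1) * L - 1/2 * r + 1/2 + x / 2) / 2"
    using kernel_moment_2[OF 3] by (simp add: k_def L_def r_def)
  have c: "legendre_coeff 1 = 1/4" "legendre_coeff 2 = 9/64"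
    by (simp_all add: legendre_coeff_Suc numeral_2_eq_2 power2_eq_square)
  have e: "(0::nat) + 1 = 1" "(0::nat) + 2 = 2" "(0::nat) + 3 = 3" by simp_all
  \<comment> \<open>At \<open>m = 0\<close> the coefficient \<open>real m ^ 2\<close> of the zeroth
    moment vanishes, so the third moment is determined by the first two.\<close>
  have "1/4 * k 1 x - 7/2 * k 2 x + 4 * k 3 x + 3/4 * (- x * (1/4)) - 2 * (x^2 * (9/64))
    = - x * (- 3/2 * k 1 x + 9/4 * k 2 x + 1/4 - 3/2 * (- x * (1/4)))"
    using kernel_moment_recurrence[of x 0, unfolded e, OF less_imp_le[OF 3]]
    by (simp add: k_def c[unfolded One_nat_def] power2_eq_square)
  hence "2 * k 3 x = (- (9/32) * x^2 + x / 4 - 3/4) * L + (9/32 * x - 7/16) * r + 7/16 + 1/8 * x - 21/64 * x^2"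
    unfolding k1 k2 by (simp add: power2_eq_square field_simps)
  thus ?case by (simp add: k_def L_def r_def numeral_3_eq_3)
next
  case (4 n x)
  define k where "k = (\<lambda>n. kernel_moment n x)"
  have IH: "s_fun (Suc (Suc n)) x = 2 * k (n + 3)" "s_fun (Suc n) x = 2 * k (n + 2)" "s_fun n x = 2 * k (n + 1)"
    using 4 by (simp_all add: k_def numeral_3_eq_3)
  define W where "W = (\<lambda>j. (- x) ^ j * legendre_coeff j)"
  have h: "coeff_h n x = - 4 * x * (2 * real n + 5/2) * W (n + 1) - 4 * (2 * real n + 7/2) * W (n + 2)
     + 4 * (2 * real n + 6) * W (n + 3) + 4 * x * (2 * real n + 5) * W (n + 2)"
    unfolding coeff_h_legendre_coeff W_def by (simp add: numeral_3_eq_3 numeral_2_eq_2 algebra_simps)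
  have e: "n + 1 + 1 = n + 2" "n + 1 + 2 = n + 3" "n + 1 + 3 = n + 4" "real (n + 1) = real n + 1"
    by simp_all
  \<comment> \<open>This is the moment recurrence at \<open>m = n + 1\<close> multiplied by
    \<open>8\<close>: a factor \<open>4\<close> from the normalization of the recurrence for
    \<open>s_fun\<close> and a factor \<open>2\<close> from
    \<open>s_fun n x = 2 * k (n + 1)\<close>.\<close>
  have alg: "4 * (M + 3)^2 * (2 * k4) = (8 * M ^ 2 + 36 * M + 42 - x * (2 * M + 5)^2) * (2 * k3)
       + (2 * x * (4 * M ^ 2 + 14 * M + 13) - (2 * M + 3)^2) * (2 * k2) + (- 4 * x * (M + 1)^2) * (2 * k1)
       + (- 4 * x * (2 * M + 5/2) * W1 - 4 * (2 * M + 7/2) * W2 + 4 * (2 * M + 6) * W3 + 4 * x * (2 * M + 5) * W2)"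
    if "(M + 1 + 1/2)^2 * k2 - (2 * (M + 1)^2 + 5 * (M + 1) + 7/2) * k3 + (M + 1 + 2)^2 * k4
      + (M + 1 + 3/4) * W2 - (M + 1 + 2) * W3
    = - x * ((M + 1)^2 * k1 - (2 * (M + 1)^2 + 3 * (M + 1) + 3/2) * k2
      + (M + 1 + 3/2)^2 * k3 + (M + 1 + 1/4) * W1 - (M + 1 + 3/2) * W2)"
    for M k1 k2 k3 k4 W1 W2 W3 :: real
    using that by (simp add: power2_eq_square algebra_simps)
  have "4 * (real n + 3)^2 * (2 * k (n + 4)) = coeff_a n x * (2 * k (n + 3)) + coeff_b n x * (2 * k (n + 2))
       + coeff_c n x * (2 * k (n + 1)) + coeff_h n x"
    unfolding h coeff_a_def coeff_b_def coeff_c_def k_def W_def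
    by (rule alg, rule kernel_moment_recurrence[of x "n + 1", unfolded e, OF less_imp_le[OF 4(4)]])
  hence "s_fun (Suc (Suc (Suc n))) x = 2 * k (n + 4)"
    unfolding s_fun.simps IH by (simp add: divide_eq_eq mult.commute)
  thus ?case by (simp add: k_def numeral_eq_Suc)
qed

subsection \<open>Integral form of the bounding functions\<close>

lemma has_integral_inverse_diff_squares:
  fixes q :: real
  assumes "q > 1"
  shows "((\<lambda>u. 2 / (q\<^sup>2 - u\<^sup>2)) has_integral (ln ((q + 1) / (q - 1)) / q)) {0..1}"
proof -
  have "((\<lambda>u. 2 / (q\<^sup>2 - u\<^sup>2)) has_integral ((ln (q + 1) - ln (q - 1)) / q - (ln (q + 0) - ln (q - 0)) / q)) {0..1}"
  proof (rule fundamental_theorem_of_calculus)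
    fix u :: real assume u: "u \<in> {0..1}"
    have "((\<lambda>u. ln (q + u)) has_field_derivative 1 / (q + u)) (at u)"
      "((\<lambda>u. ln (q - u)) has_field_derivative - (1 / (q - u))) (at u)"
      using u assms by (auto intro!: derivative_eq_intros)
    from DERIV_cdivide[OF DERIV_diff[OF this], of q]
    have "((\<lambda>u. (ln (q + u) - ln (q - u)) / q) has_field_derivative (1 / (q + u) + 1 / (q - u)) / q) (at u)"
      by simp
    also have "(1 / (q + u) + 1 / (q - u)) / q = 2 / (q\<^sup>2 - u\<^sup>2)"
    proof -
      have nz: "q + u \<noteq> 0" "q - u \<noteq> 0" "q \<noteq> 0" using u assms by auto
      have "1 / (q + u) + 1 / (q - u) = 2 * q / ((q + u) * (q - u))"
        using nz by (simp add: add_divide_eq_iff divide_simps)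
      also have "(q + u) * (q - u) = q\<^sup>2 - u\<^sup>2" by (simp add: power2_eq_square algebra_simps)
      finally show ?thesis using nz by simp
    qed
    finally show "((\<lambda>u. (ln (q + u) - ln (q - u)) / q) has_vector_derivative 2 / (q\<^sup>2 - u\<^sup>2)) (at u within {0..1})"
      unfolding has_real_derivative_iff_has_vector_derivative
      by (rule has_vector_derivative_at_within)
  qed simp
  thus ?thesis using assms by (simp add: ln_div)
qed

lemma one_minus_mult_power2_pos:
  fixes l u :: real
  assumes "0 < l" "l < 1" "u \<in> {0..1}"
  shows "1 - l\<^sup>2 * u\<^sup>2 > 0"
proof -
  have "l\<^sup>2 * u\<^sup>2 \<le> l\<^sup>2 * 1"
    using assms by (intro mult_left_mono) (auto simp: abs_square_le_1)
  also have "l\<^sup>2 < 1" using assms by (simp add: abs_square_less_1)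
  finally show ?thesis by simp
qed

lemma has_integral_inverse_one_minus_squares:
  fixes l :: real
  assumes "0 < l" "l < 1"
  shows "((\<lambda>u. l / (1 - l\<^sup>2 * u\<^sup>2)) has_integral (1/2 * ln ((1 + l) / (1 - l)))) {0..1}"
proof -
  have "((\<lambda>u. 1 / (2 * l) * (2 / ((1 / l)\<^sup>2 - u\<^sup>2))) has_integral
      1 / (2 * l) * (ln ((1 / l + 1) / (1 / l - 1)) / (1 / l))) {0..1}"
    by (intro has_integral_mult_right has_integral_inverse_diff_squares) (use assms in simp)
  also have "(1 / l + 1) / (1 / l - 1) = (1 + l) / (1 - l)"
    using assms by (simp add: divide_simps)
  also have "1 / (2 * l) * (ln ((1 + l) / (1 - l)) / (1 / l)) = 1/2 * ln ((1 + l) / (1 - l))"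
    using assms by simp
  finally show ?thesis
  proof (rule has_integral_eq[rotated])
    fix u :: real assume "u \<in> {0..1}"
    hence "1 - l\<^sup>2 * u\<^sup>2 \<noteq> 0" using one_minus_mult_power2_pos[OF assms, of u] by simp
    moreover have "(1 / l)\<^sup>2 - u\<^sup>2 = (1 - l\<^sup>2 * u\<^sup>2) / l\<^sup>2"
      using assms by (simp add: power_divide diff_divide_distrib)
    ultimately show "1 / (2 * l) * (2 / ((1 / l)\<^sup>2 - u\<^sup>2)) = l / (1 - l\<^sup>2 * u\<^sup>2)"
      using assms by (simp add: power2_eq_square)
  qed
qed

definition ell_scale :: "real \<Rightarrow> real \<Rightarrow> real" where
  "ell_scale l k = (1 - k\<^sup>2) * l\<^sup>2 / (1 - l\<^sup>2)"

lemma ell_scale_pos: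
  assumes "0 < l" "l < 1" "0 \<le> k" "k < 1"
  shows "ell_scale l k > 0"
  using assms by (auto simp: ell_scale_def power_less_one_iff abs_square_less_1)

lemma alpha_pos: "alpha N > 0"
  by (simp add: alpha_def add_pos_pos)

lemma alpha_less_one: "alpha N < 1"
  unfolding alpha_def by (auto simp: divide_less_eq add_pos_pos intro!: power_strict_mono)

lemma alpha_strict_mono:
  assumes "M < N"
  shows "alpha M < alpha N"
proof -
  have "(real M + 1/2) / (real M + 1) < (real N + 1/2) / (real N + 1)"
    using assms by (simp add: divide_simps) (simp add: algebra_simps)
  hence "((real M + 1/2) / (real M + 1))\<^sup>2 < ((real N + 1/2) / (real N + 1))\<^sup>2"
    by (intro power_strict_mono) auto
  thus ?thesis by (simp add: alpha_def power_divide)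
qed

definition f_integrand :: "nat \<Rightarrow> real \<Rightarrow> real \<Rightarrow> real \<Rightarrow> real" where
  "f_integrand N l k u = l / (1 - l\<^sup>2 * u\<^sup>2) * (ell_scale l k * (1 - u\<^sup>2) / (1 + alpha N * (ell_scale l k * (1 - u\<^sup>2))))"

lemma ell_scale_mult_nonneg:
  assumes "0 < l" "l < 1" "0 \<le> k" "k < 1" "u \<in> {0..1}"
  shows "ell_scale l k * (1 - u\<^sup>2) \<ge> 0"
  using ell_scale_pos[of l k] assms by (intro mult_nonneg_nonneg) (auto simp: abs_square_le_1)

text \<open>Partial fractions: the two denominators \<open>A\<close> and \<open>B\<close> of the
  integrand satisfy \<open>A - B = l^2 * (1 - u^2) * (1 - a * m)\<close>, whence the prefactor
  \<open>1 / (1 - a * m)\<close> and the two logarithms. From this form positivity, monotonicity and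
  size can be read off pointwise.\<close>

lemma f_bound_has_integral:
  assumes lk: "0 < l" "l < 1" "0 \<le> k" "k < 1"
  shows "((\<lambda>u. 2 * f_integrand N l k u) has_integral f_bound N l k) {0..1}"
proof -
  define m where "m = 1 - k\<^sup>2"
  define a where "a = alpha N"
  define q where "q = sqrt (1 + (1 - l\<^sup>2) / (a * l\<^sup>2 * m))"
  have m: "0 < m" "m \<le> 1" using lk by (auto simp: m_def abs_square_less_1)
  have a: "0 < a" "a < 1" using alpha_pos alpha_less_one by (auto simp: a_def)
  have am: "a * m < 1" using mult_le_cancel_left_pos[of a m 1] a m by linarith
  have l2: "0 < l\<^sup>2" "l\<^sup>2 < 1" using lk by (auto simp: abs_square_less_1)
  have p: "(1 - l\<^sup>2) / (a * l\<^sup>2 * m) > 0" using a m l2 by simp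
  have q: "q > 1" using p by (simp add: q_def)
  have q2: "q\<^sup>2 = 1 + (1 - l\<^sup>2) / (a * l\<^sup>2 * m)" using p by (simp add: q_def)
  have "((\<lambda>u. 1 / (1 - a * m) * (1 / (a * l) * (2 / (q\<^sup>2 - u\<^sup>2)) - 2 * m * (l / (1 - l\<^sup>2 * u\<^sup>2)))) has_integral
      1 / (1 - a * m) * (1 / (a * l) * (ln ((q + 1) / (q - 1)) / q) - 2 * m * (1/2 * ln ((1 + l) / (1 - l))))) {0..1}"
    by (intro has_integral_mult_right has_integral_diff has_integral_inverse_diff_squares q
        has_integral_inverse_one_minus_squares lk)
  also have "1 / (1 - a * m) * (1 / (a * l) * (ln ((q + 1) / (q - 1)) / q) - 2 * m * (1/2 * ln ((1 + l) / (1 - l)))) = f_bound N l k"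
    unfolding f_bound_def Let_def a_def[symmetric] m_def[symmetric] q_def[symmetric] by simp
  finally show ?thesis
  proof (rule has_integral_eq[rotated])
    fix u :: real assume u: "u \<in> {0..1}"
    define v where "v = 1 - u\<^sup>2"
    have v: "0 \<le> v" using u by (auto simp: v_def abs_square_le_1)
    define A where "A = 1 - l\<^sup>2 * u\<^sup>2"
    define B where "B = 1 - l\<^sup>2 + a * m * l\<^sup>2 * v"
    have A: "A > 0" using one_minus_mult_power2_pos lk u by (auto simp: A_def)
    have B: "B > 0" unfolding B_def using a m l2 v by (intro add_pos_nonneg) auto
    have "q\<^sup>2 - u\<^sup>2 = B / (a * l\<^sup>2 * m)"
      unfolding q2 B_def v_def using a m l2 by (simp add: divide_simps) (simp add: algebra_simps)
    hence 1: "1 / (a * l) * (2 / (q\<^sup>2 - u\<^sup>2)) = 2 * m * l / B"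
      by (simp only:) (use a m l2 B lk(1) in \<open>simp add: divide_simps power2_eq_square\<close>)
    have "1 + a * (ell_scale l k * v) = B / (1 - l\<^sup>2)"
      using l2 unfolding ell_scale_def B_def m_def by (simp add: divide_simps)
    hence 2: "2 * f_integrand N l k u = 2 * m * l^3 * v / (A * B)"
      unfolding f_integrand_def a_def[symmetric] A_def[symmetric] v_def[symmetric] ell_scale_def m_def[symmetric]
      using l2 A B by (simp add: divide_simps power2_eq_square power3_eq_cube)
    have AB: "A - B = l\<^sup>2 * v * (1 - a * m)"
      unfolding A_def B_def v_def by (simp add: algebra_simps)
    have "2 * m * l / B - 2 * m * (l / A) = 2 * m * l * (A - B) / (A * B)"
      using A B by (simp add: field_simps)
    also have "\<dots> = 2 * m * l^3 * v / (A * B) * (1 - a * m)"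
      unfolding AB by (simp add: power2_eq_square power3_eq_cube)
    finally show "1 / (1 - a * m) * (1 / (a * l) * (2 / (q\<^sup>2 - u\<^sup>2)) - 2 * m * (l / (1 - l\<^sup>2 * u\<^sup>2))) = 2 * f_integrand N l k u"
      unfolding 1 2 A_def[symmetric] using am by simp
  qed
qed

lemma f_bound_eq:
  assumes "0 < l" "l < 1" "0 \<le> k" "k < 1"
  shows "f_bound N l k = 2 * integral {0..1} (f_integrand N l k)"
  using integral_unique[OF f_bound_has_integral[OF assms]] by simp

lemma continuous_on_f_integrand:
  assumes "0 < l" "l < 1" "0 \<le> k" "k < 1"
  shows "continuous_on {0..1} (f_integrand N l k)"
proof -
  have "1 - l\<^sup>2 * u\<^sup>2 \<noteq> 0" "1 + alpha N * (ell_scale l k * (1 - u\<^sup>2)) \<noteq> 0" if "u \<in> {0..1}" for u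
    using one_minus_mult_power2_pos[of l u] mult_nonneg_nonneg[OF less_imp_le[OF alpha_pos[of N]] ell_scale_mult_nonneg[OF assms that]] assms that
    by linarith+
  thus ?thesis unfolding f_integrand_def[abs_def] by (auto intro!: continuous_intros)
qed

text \<open>For \<open>X > 0\<close> the kernel \<open>X / (1 + a * X)\<close> decreases strictly in
  \<open>a\<close>, and \<open>alpha\<close> is strictly increasing.\<close>

lemma f_bound_strict_antimono:
  assumes lk: "0 < l" "l < 1" "0 \<le> k" "k < 1" and "M < N"
  shows "f_bound N l k < f_bound M l k"
proof -
  have "integral {0..1} (f_integrand N l k) < integral {0..1} (f_integrand M l k)"
  proof (rule integral_less_real)
    fix u :: real assume u: "u \<in> {0<..<1}"
    define X where "X = ell_scale l k * (1 - u\<^sup>2)"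
    have X: "X > 0" using ell_scale_pos[OF lk] u by (auto simp: X_def abs_square_less_1)
    have A: "l / (1 - l\<^sup>2 * u\<^sup>2) > 0" using one_minus_mult_power2_pos[of l u] lk u by auto
    have "X / (1 + alpha N * X) < X / (1 + alpha M * X)"
      using X alpha_pos[of M] alpha_pos[of N] alpha_strict_mono[OF assms(5)]
      by (intro divide_strict_left_mono) (auto intro!: mult_pos_pos add_pos_pos)
    thus "f_integrand N l k u < f_integrand M l k u"
      unfolding f_integrand_def X_def[symmetric] using A by (rule mult_strict_left_mono)
  qed (use lk continuous_on_f_integrand in auto)
  thus ?thesis by (simp add: f_bound_eq lk)
qed

lemma f_bound_pos:
  assumes lk: "0 < l" "l < 1" "0 \<le> k" "k < 1"
  shows "f_bound N l k > 0"
proof -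
  have "integral {0..1} (\<lambda>_::real. 0::real) < integral {0..1} (f_integrand N l k)"
  proof (rule integral_less_real)
    fix u :: real assume u: "u \<in> {0<..<1}"
    define X where "X = ell_scale l k * (1 - u\<^sup>2)"
    have X: "X > 0" using ell_scale_pos[OF lk] u by (auto simp: X_def abs_square_less_1)
    have A: "l / (1 - l\<^sup>2 * u\<^sup>2) > 0" using one_minus_mult_power2_pos[of l u] lk u by auto
    have "X / (1 + alpha N * X) > 0"
      using X alpha_pos[of N] by (intro divide_pos_pos) (auto intro!: mult_pos_pos add_pos_pos)
    thus "0 < f_integrand N l k u"
      unfolding f_integrand_def X_def[symmetric] using A by (intro mult_pos_pos)
  qed (use lk continuous_on_f_integrand in auto)
  thus ?thesis by (simp add: f_bound_eq lk)
qed

text \<open>Discard the denominator \<open>1 + alpha N * X\<close>, which is at least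
  \<open>1\<close>, and use \<open>(1 - u^2) / (1 - l^2 * u^2) \<le> 1\<close>. The factor
  \<open>4\<close> combines the \<open>2\<close> of \<open>f_bound_eq\<close> with
  \<open>1 + k \<le> 2\<close>.\<close>

lemma f_bound_le:
  assumes lk: "0 < l" "l < 1" "0 \<le> k" "k < 1"
  shows "f_bound N l k \<le> 4 * ((1 - k) / (1 - l))"
proof -
  define m where "m = 1 - k\<^sup>2"
  have m: "0 < m" using lk by (auto simp: m_def abs_square_less_1)
  have l2: "0 < l\<^sup>2" "l\<^sup>2 < 1" using lk by (auto simp: abs_square_less_1)
  have le: "f_integrand N l k u \<le> m / (1 - l\<^sup>2)" if u: "u \<in> {0..1}" for u
  proof -
    define X where "X = ell_scale l k * (1 - u\<^sup>2)"
    have X: "X \<ge> 0" unfolding X_def by (rule ell_scale_mult_nonneg[OF lk u])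
    have A: "1 - l\<^sup>2 * u\<^sup>2 > 0" using one_minus_mult_power2_pos[of l u] lk u by auto
    have "f_integrand N l k u \<le> l / (1 - l\<^sup>2 * u\<^sup>2) * (X / 1)"
      unfolding f_integrand_def X_def[symmetric] using A lk(1) X alpha_pos[of N]
      by (intro mult_left_mono divide_left_mono) (auto intro!: add_pos_nonneg)
    also have "\<dots> = m / (1 - l\<^sup>2) * (l^3 * ((1 - u\<^sup>2) / (1 - l\<^sup>2 * u\<^sup>2)))"
      unfolding X_def ell_scale_def m_def by (simp add: power2_eq_square power3_eq_cube mult_ac)
    also have "\<dots> \<le> m / (1 - l\<^sup>2) * 1"
    proof (intro mult_left_mono mult_le_one)
      have "l\<^sup>2 * u\<^sup>2 \<le> 1 * u\<^sup>2" using l2 by (intro mult_right_mono) auto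
      thus "(1 - u\<^sup>2) / (1 - l\<^sup>2 * u\<^sup>2) \<le> 1" using A by (simp add: divide_le_eq)
      show "0 \<le> (1 - u\<^sup>2) / (1 - l\<^sup>2 * u\<^sup>2)"
        using A u by (intro divide_nonneg_nonneg) (auto simp: abs_square_le_1)
    qed (use lk m l2 in \<open>auto simp: power_le_one\<close>)
    finally show ?thesis by simp
  qed
  have "integral {0..1} (f_integrand N l k) \<le> integral {0..1::real} (\<lambda>_. m / (1 - l\<^sup>2))"
    by (intro integral_le integrable_continuous_real continuous_on_f_integrand lk le) auto
  hence "f_bound N l k \<le> 2 * (m / (1 - l\<^sup>2))" by (simp add: f_bound_eq lk)
  also have "m / (1 - l\<^sup>2) \<le> (2 * (1 - k)) / (1 - l)"
  proof (rule frac_le)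
    have "m = (1 + k) * (1 - k)" by (simp add: m_def power2_eq_square algebra_simps)
    also have "\<dots> \<le> 2 * (1 - k)" using lk by (intro mult_right_mono) auto
    finally show "m \<le> 2 * (1 - k)" .
    have "l * l \<le> 1 * l" using lk by (intro mult_right_mono) auto
    thus "1 - l \<le> 1 - l\<^sup>2" by (simp add: power2_eq_square)
  qed (use lk in auto)
  finally show ?thesis by simp
qed

subsection \<open>Integral representation of the elliptic integral\<close>

lemma ellF_denominator_pos:
  fixes t y l :: real
  assumes "l < 1" "t \<in> {0..l}" "y \<in> {0..1}"
  shows "1 - (1 - y) * t\<^sup>2 > 0"
proof -
  have "(1 - y) * t\<^sup>2 \<le> 1 * t\<^sup>2" using assms by (intro mult_right_mono) auto
  also have "\<dots> < 1" using assms by (simp add: abs_square_less_1)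
  finally show ?thesis by simp
qed

lemma modulus_mem_unit:
  assumes "0 \<le> k" "k < 1" "s \<in> {0..1::real}"
  shows "(1 - k\<^sup>2) * s \<in> {0..1}"
  using assms by (intro mult_mem_unit) (auto simp: abs_square_le_1)

text \<open>Since \<open>1 - k^2 * t^2 = (1 - t^2) * (1 + z)\<close> with
  \<open>z = (1 - k^2) * t^2 / (1 - t^2)\<close>, the factor \<open>1 - t^2\<close> leaves the
  square root and the rest is a mean of Cauchy kernels.\<close>

lemma ellF_eq_arcsine_mean:
  assumes lk: "0 < l" "l < 1" "0 \<le> k" "k < 1"
  shows "ellF l k = arcsine_mean (\<lambda>s. integral {0..l} (\<lambda>t. 1 / (1 - (1 - (1 - k\<^sup>2) * s) * t\<^sup>2)))"
proof -
  define m where "m = 1 - k\<^sup>2"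
  have m: "m \<ge> 0" using lk by (simp add: m_def abs_square_le_1)
  have "1 / sqrt ((1 - t\<^sup>2) * (1 - k\<^sup>2 * t\<^sup>2)) = arcsine_mean (\<lambda>s. 1 / (1 - (1 - m * s) * t\<^sup>2))"
    if t: "t \<in> {0..l}" for t
  proof -
    have t2: "1 - t\<^sup>2 > 0" using t lk by (simp add: abs_square_less_1)
    define z where "z = m * t\<^sup>2 / (1 - t\<^sup>2)"
    have z: "z \<ge> 0" using t2 m by (simp add: z_def)
    have 1: "1 - (1 - m * s) * t\<^sup>2 = (1 - t\<^sup>2) * (1 + z * s)" for s
      using t2 by (simp add: z_def field_simps)
    have "sqrt ((1 - t\<^sup>2) * (1 - k\<^sup>2 * t\<^sup>2)) = sqrt ((1 - t\<^sup>2)\<^sup>2 * (1 + z))"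
      using 1[of 1] by (simp add: m_def power2_eq_square mult.assoc)
    also have "\<dots> = (1 - t\<^sup>2) * sqrt (1 + z)"
      using t2 by (simp add: real_sqrt_mult)
    finally have "1 / sqrt ((1 - t\<^sup>2) * (1 - k\<^sup>2 * t\<^sup>2)) = 1 / (1 - t\<^sup>2) * arcsine_mean (\<lambda>s. 1 / (1 + z * s))"
      unfolding arcsine_mean_cauchy_kernel[OF z] by simp
    also have "\<dots> = arcsine_mean (\<lambda>s. 1 / (1 - (1 - m * s) * t\<^sup>2))"
      unfolding 1 arcsine_mean_cmult[symmetric] by simp
    finally show ?thesis .
  qed
  hence "ellF l k = integral {0..l} (\<lambda>t. arcsine_mean (\<lambda>s. 1 / (1 - (1 - m * s) * t\<^sup>2)))"
    unfolding ellF_def by (intro integral_cong)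
  also have "\<dots> = arcsine_mean (\<lambda>s. integral {0..l} (\<lambda>t. 1 / (1 - (1 - m * s) * t\<^sup>2)))"
  proof (rule arcsine_mean_integral_swap[symmetric])
    have "1 - (1 - m * fst y) * (snd y)\<^sup>2 \<noteq> 0" if "y \<in> {0..1} \<times> {0..l}" for y
      using ellF_denominator_pos[OF lk(2), of "snd y" "m * fst y"] modulus_mem_unit[OF lk(3,4), of "fst y"] that
      by (auto simp: m_def)
    hence "continuous_on ({0..1} \<times> {0..l}) (\<lambda>y. 1 / (1 - (1 - m * fst y) * (snd y)\<^sup>2))"
      by (auto intro!: continuous_intros)
    thus "continuous_on ({0..1} \<times> {0..l}) (\<lambda>(s, t). 1 / (1 - (1 - m * s) * t\<^sup>2))"
      by (simp add: case_prod_unfold)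
  qed
  finally show ?thesis unfolding m_def .
qed

text \<open>The substitution \<open>t = l u sqrt (1 - l\<^sup>2) / sqrt (1 - l\<^sup>2 + y l\<^sup>2 (1 - u\<^sup>2))\<close> moves the
  dependence on \<open>y\<close> into a single square root.\<close>

lemma artanh_integral_substitution:
  fixes l y :: real
  assumes l: "0 < l" "l < 1" and y: "y \<in> {0..1}"
  shows "integral {0..l} (\<lambda>t. 1 / (1 - (1 - y) * t\<^sup>2))
    = integral {0..1} (\<lambda>u. l / (1 - l\<^sup>2 * u\<^sup>2) * (1 / sqrt (1 + y * l\<^sup>2 * (1 - u\<^sup>2) / (1 - l\<^sup>2))))"
proof -
  define c where "c = 1 - l\<^sup>2"
  define d where "d = (\<lambda>u. c + y * l\<^sup>2 * (1 - u\<^sup>2))"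
  define g where "g = (\<lambda>u. l * sqrt c * u / sqrt (d u))"
  define g' where "g' = (\<lambda>u. l * sqrt c * (c + y * l\<^sup>2) / (d u * sqrt (d u)))"
  have c: "c > 0" using l by (simp add: c_def abs_square_less_1)
  have dc: "d u \<ge> c" if "u \<in> {0..1}" for u
    using that y by (auto simp: d_def abs_square_le_1)
  have d: "d u > 0" if "u \<in> {0..1}" for u using dc[OF that] c by simp
  have g01: "g 0 = 0" "g 1 = l" using c by (simp_all add: g_def d_def)
  have "((\<lambda>u. g' u *\<^sub>R (1 / (1 - (1 - y) * (g u)\<^sup>2))) has_integral
      integral {g 0..g 1} (\<lambda>t. 1 / (1 - (1 - y) * t\<^sup>2))) {0..1}"
  proof (rule has_integral_substitution)
    show "g ` {0..1} \<subseteq> {0..l}"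
    proof
      fix t assume "t \<in> g ` {0..1}"
      then obtain u where u: "u \<in> {0..1}" "t = g u" by blast
      have "sqrt c * u \<le> sqrt (d u) * 1"
        using u dc[OF u(1)] d[OF u(1)] by (intro mult_mono) auto
      hence "sqrt c * u / sqrt (d u) \<le> 1" using d[OF u(1)] by (simp add: divide_le_eq)
      hence "l * (sqrt c * u / sqrt (d u)) \<le> l * 1" using l by (intro mult_left_mono) auto
      moreover have "0 \<le> g u" using u l c d[OF u(1)] by (simp add: g_def)
      ultimately show "t \<in> {0..l}" unfolding u(2) by (simp add: g_def mult.assoc)
    qed
    show "continuous_on {0..l} (\<lambda>t. 1 / (1 - (1 - y) * t\<^sup>2))"
      by (intro continuous_intros ballI less_imp_neq[symmetric] ellF_denominator_pos[OF l(2) _ y])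
    fix u :: real assume u: "u \<in> {0..1}"
    have D: "((\<lambda>u. sqrt (d u)) has_field_derivative (inverse (sqrt (d u)) / 2) * (- (2 * y * l\<^sup>2 * u))) (at u)"
      unfolding d_def
      by (rule DERIV_chain2[where f = sqrt and g = "\<lambda>u. c + y * l\<^sup>2 * (1 - u\<^sup>2)", OF DERIV_real_sqrt])
         (use d[OF u] in \<open>auto simp: d_def intro!: derivative_eq_intros\<close>)
    have sd: "sqrt (d u) > 0" "sqrt (d u) * sqrt (d u) = d u" using d[OF u] by auto
    have "(g has_field_derivative ((l * sqrt c * 1) * sqrt (d u)
        - l * sqrt c * u * ((inverse (sqrt (d u)) / 2) * (- (2 * y * l\<^sup>2 * u)))) / (sqrt (d u) * sqrt (d u))) (at u)"
      unfolding g_def using sd(1) by (intro DERIV_divide DERIV_cmult DERIV_ident D) simp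
    also have "((l * sqrt c * 1) * sqrt (d u)
        - l * sqrt c * u * ((inverse (sqrt (d u)) / 2) * (- (2 * y * l\<^sup>2 * u)))) / (sqrt (d u) * sqrt (d u))
        = l * sqrt c * (sqrt (d u) * sqrt (d u) + y * l\<^sup>2 * u\<^sup>2) / (d u * sqrt (d u))"
    proof -
      have "((a * 1) * r - a * u * ((inverse r / 2) * (- (2 * b * u)))) / (r * r) = a * (r * r + b * u\<^sup>2) / ((r * r) * r)"
        if "r > 0" for a b r :: real
        using that by (simp add: field_simps power2_eq_square)
      from this[OF sd(1), of "l * sqrt c" "y * l\<^sup>2"] show ?thesis
        unfolding sd(2) by (simp add: mult.assoc)
    qed
    also have "\<dots> = g' u"
    proof -
      have "d u + y * l\<^sup>2 * u\<^sup>2 = c + y * l\<^sup>2" by (simp add: d_def algebra_simps)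
      thus ?thesis unfolding sd(2) g'_def by simp
    qed
    finally show "(g has_field_derivative g' u) (at u within {0..1})"
      by (rule has_field_derivative_at_within)
  qed (use g01 l in auto)
  hence "((\<lambda>u. l / (1 - l\<^sup>2 * u\<^sup>2) * (1 / sqrt (1 + y * l\<^sup>2 * (1 - u\<^sup>2) / c))) has_integral
      integral {0..l} (\<lambda>t. 1 / (1 - (1 - y) * t\<^sup>2))) {0..1}"
    unfolding g01
  proof (rule has_integral_eq[rotated])
    fix u :: real assume u: "u \<in> {0..1}"
    have sd: "sqrt (d u) > 0" "(sqrt (d u))\<^sup>2 = d u" "d u > 0" using d[OF u] by auto
    have sc: "sqrt c > 0" "(sqrt c)\<^sup>2 = c" "sqrt c * sqrt c = c" using c by auto
    have A: "1 - l\<^sup>2 * u\<^sup>2 > 0" by (rule one_minus_mult_power2_pos[OF l u])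
    have e: "c + y * l\<^sup>2 > 0" using c y by (intro add_pos_nonneg) auto
    have g2: "(g u)\<^sup>2 = l\<^sup>2 * c * u\<^sup>2 / d u"
      by (simp add: g_def power_mult_distrib power_divide sd(2) sc(2))
    \<comment> \<open>The substitution works because of this factorization:
      \<open>c + y * l^2\<close> cancels against \<open>g'\<close>, leaving a weight free of
      \<open>y\<close> times one inverse square root.\<close>
    have "d u - (1 - y) * (l\<^sup>2 * c * u\<^sup>2) = (1 - l\<^sup>2 * u\<^sup>2) * (c + y * l\<^sup>2)"
      unfolding d_def c_def by (simp add: power2_eq_square algebra_simps)
    hence 1: "1 - (1 - y) * (g u)\<^sup>2 = (1 - l\<^sup>2 * u\<^sup>2) * (c + y * l\<^sup>2) / d u"
      unfolding g2 using sd(3) by (simp add: field_simps)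
    have "1 + y * l\<^sup>2 * (1 - u\<^sup>2) / c = d u / c" using c by (simp add: d_def field_simps)
    hence 2: "sqrt (1 + y * l\<^sup>2 * (1 - u\<^sup>2) / c) = sqrt (d u) / sqrt c"
      by (simp add: real_sqrt_divide)
    show "g' u *\<^sub>R (1 / (1 - (1 - y) * (g u)\<^sup>2)) = l / (1 - l\<^sup>2 * u\<^sup>2) * (1 / sqrt (1 + y * l\<^sup>2 * (1 - u\<^sup>2) / c))"
      unfolding 1 2 g'_def using sd(1,3) sc(1) A e by simp
  qed
  thus ?thesis unfolding c_def by (simp add: integral_unique)
qed

lemma ell_scale_denominator_pos:
  assumes "0 < l" "l < 1" "0 \<le> k" "k < 1" "u \<in> {0..1}" "s \<in> {0..1::real}"
  shows "1 + ell_scale l k * (1 - u\<^sup>2) * s > 0"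
proof -
  have "0 \<le> ell_scale l k * (1 - u\<^sup>2) * s"
    by (rule mult_nonneg_nonneg[OF ell_scale_mult_nonneg[OF assms(1-5)]]) (use assms(6) in simp)
  thus ?thesis by linarith
qed

text \<open>After the substitution the first arcsine variable occurs only in
  \<open>1 / sqrt (1 + X u * s)\<close>; reading the Cauchy kernel formula backwards introduces the
  second one.\<close>

lemma ellF_eq_integral_prod_mean:
  assumes lk: "0 < l" "l < 1" "0 \<le> k" "k < 1"
  shows "ellF l k = integral {0..1} (\<lambda>u. l / (1 - l\<^sup>2 * u\<^sup>2)
      * arcsine_prod_mean (\<lambda>s. 1 / (1 + ell_scale l k * (1 - u\<^sup>2) * s)))"
proof -
  define X where "X = (\<lambda>u. ell_scale l k * (1 - u\<^sup>2))"
  define w where "w = (\<lambda>u. l / (1 - l\<^sup>2 * u\<^sup>2))"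
  have X: "X u \<ge> 0" if "u \<in> {0..1}" for u unfolding X_def by (rule ell_scale_mult_nonneg[OF lk that])
  have "ellF l k = arcsine_mean (\<lambda>s. integral {0..1} (\<lambda>u. w u * (1 / sqrt (1 + X u * s))))"
    unfolding ellF_eq_arcsine_mean[OF lk]
  proof (rule arcsine_mean_cong)
    fix s :: real assume s: "s \<in> {0..1}"
    show "integral {0..l} (\<lambda>t. 1 / (1 - (1 - (1 - k\<^sup>2) * s) * t\<^sup>2)) = integral {0..1} (\<lambda>u. w u * (1 / sqrt (1 + X u * s)))"
      unfolding artanh_integral_substitution[OF lk(1,2) modulus_mem_unit[OF lk(3,4) s]]
      by (simp add: w_def X_def ell_scale_def mult_ac)
  qed
  also have "\<dots> = integral {0..1} (\<lambda>u. arcsine_mean (\<lambda>s. w u * (1 / sqrt (1 + X u * s))))"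
  proof (rule arcsine_mean_integral_swap)
    have "1 - l\<^sup>2 * (snd y)\<^sup>2 \<noteq> 0" "0 < 1 + X (snd y) * fst y" if "y \<in> {0..1} \<times> {0..1}" for y
      using one_minus_mult_power2_pos[OF lk(1,2), of "snd y"] ell_scale_denominator_pos[OF lk, of "snd y" "fst y"] that
      by (auto simp: X_def)
    hence "continuous_on ({0..1} \<times> {0..1}) (\<lambda>y. w (snd y) * (1 / sqrt (1 + X (snd y) * fst y)))"
      unfolding w_def X_def by (intro continuous_intros ballI) (auto simp: less_imp_neq[symmetric])
    thus "continuous_on ({0..1} \<times> {0..1}) (\<lambda>(s, u). w u * (1 / sqrt (1 + X u * s)))"
      by (simp add: case_prod_unfold)
  qed
  also have "\<dots> = integral {0..1} (\<lambda>u. w u * arcsine_prod_mean (\<lambda>s. 1 / (1 + X u * s)))"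
  proof (rule integral_cong)
    fix u :: real assume u: "u \<in> {0..1}"
    have "arcsine_prod_mean (\<lambda>s. 1 / (1 + X u * s)) = arcsine_mean (\<lambda>s. 1 / sqrt (1 + X u * s))"
      unfolding arcsine_prod_mean_def
    proof (rule arcsine_mean_cong)
      fix s :: real assume "s \<in> {0..1}"
      thus "arcsine_mean (\<lambda>t. 1 / (1 + X u * (s * t))) = 1 / sqrt (1 + X u * s)"
        using arcsine_mean_cauchy_kernel[of "X u * s"] X[OF u] by (simp add: mult.assoc)
    qed
    thus "arcsine_mean (\<lambda>s. w u * (1 / sqrt (1 + X u * s))) = w u * arcsine_prod_mean (\<lambda>s. 1 / (1 + X u * s))"
      by (simp only: arcsine_mean_cmult)
  qed
  finally show ?thesis unfolding w_def X_def .
qed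

section \<open>Stieltjes moments and their bounds by Cauchy kernels\<close>

definition stieltjes_moment :: "nat \<Rightarrow> real \<Rightarrow> real" where
  "stieltjes_moment n X = arcsine_prod_mean (\<lambda>s. s ^ n / (1 + X * s))"

lemma stieltjes_continuous:
  assumes "X \<ge> 0"
  shows "continuous_on {0..1} (\<lambda>s::real. s ^ n / (1 + X * s))"
proof -
  have "1 + X * s > 0" if "s \<in> {0..1}" for s using assms that by (intro add_pos_nonneg) auto
  thus ?thesis by (intro continuous_intros) force
qed

lemma stieltjes_moment_Suc:
  assumes "X \<ge> 0"
  shows "stieltjes_moment n X = legendre_coeff n - X * stieltjes_moment (Suc n) X"
proof -
  have "legendre_coeff n = arcsine_prod_mean (\<lambda>s. s ^ n / (1 + X * s) + X * (s ^ Suc n / (1 + X * s)))"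
    unfolding arcsine_prod_mean_power[symmetric]
  proof (rule arcsine_prod_mean_cong)
    fix s :: real assume "s \<in> {0..1}"
    hence "1 + X * s > 0" using assms by (intro add_pos_nonneg) auto
    hence "s ^ n = s ^ n * (1 + X * s) / (1 + X * s)" by simp
    also have "\<dots> = s ^ n / (1 + X * s) + X * (s ^ Suc n / (1 + X * s))"
      by (simp add: distrib_left add_divide_distrib mult_ac)
    finally show "s ^ n = s ^ n / (1 + X * s) + X * (s ^ Suc n / (1 + X * s))" .
  qed
  also have "\<dots> = stieltjes_moment n X + X * stieltjes_moment (Suc n) X"
    unfolding stieltjes_moment_def arcsine_prod_mean_cmult[symmetric]
    by (intro arcsine_prod_mean_add continuous_on_mult continuous_on_const stieltjes_continuous assms)
  finally show ?thesis by simp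
qed

text \<open>Jensen's inequality for the convex function \<open>s \<mapsto> 1 / (1 + X s)\<close>, via its tangent at \<open>alpha n\<close>,
  the mean of the weight \<open>s ^ n\<close>.\<close>

lemma stieltjes_moment_lower:
  assumes "X \<ge> 0"
  shows "legendre_coeff n / (1 + alpha n * X) \<le> stieltjes_moment n X"
proof -
  define a where "a = alpha n"
  have a: "a > 0" by (simp add: a_def alpha_pos)
  have p: "1 + a * X > 0" using a assms by (intro add_pos_nonneg) auto
  let ?A = "1 / (1 + a * X) + X * a / (1 + a * X)\<^sup>2" and ?B = "- (X / (1 + a * X)\<^sup>2)"
  have "arcsine_prod_mean (\<lambda>s. ?A * s ^ n + ?B * s ^ Suc n) \<le> stieltjes_moment n X"
    unfolding stieltjes_moment_def
  proof (rule arcsine_prod_mean_mono)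
    fix s :: real assume s: "s \<in> {0..1}"
    have q: "1 + X * s > 0" using s assms by (intro add_pos_nonneg) auto
    have "1 / (1 + X * s) - (?A + ?B * s) = (X * (s - a))\<^sup>2 / ((1 + X * s) * (1 + a * X)\<^sup>2)"
      using p q by (simp add: divide_simps) (simp add: power2_eq_square algebra_simps)
    also have "\<dots> \<ge> 0" using q by (intro divide_nonneg_nonneg mult_nonneg_nonneg) auto
    finally have "?A + ?B * s \<le> 1 / (1 + X * s)" by simp
    hence "s ^ n * (?A + ?B * s) \<le> s ^ n * (1 / (1 + X * s))" using s by (intro mult_left_mono) auto
    thus "?A * s ^ n + ?B * s ^ Suc n \<le> s ^ n / (1 + X * s)" by (simp add: algebra_simps)
  qed (intro continuous_intros stieltjes_continuous assms)+
  also have "arcsine_prod_mean (\<lambda>s. ?A * s ^ n + ?B * s ^ Suc n) = ?A * legendre_coeff n + ?B * legendre_coeff (Suc n)"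
    unfolding arcsine_prod_mean_power[symmetric] arcsine_prod_mean_cmult[symmetric]
    by (intro arcsine_prod_mean_add continuous_intros)
  \<comment> \<open>The slope terms cancel because the tangent point \<open>a\<close> is the mean of
    \<open>s\<close> under the weight.\<close>
  also have "\<dots> = legendre_coeff n / (1 + a * X)"
    unfolding legendre_coeff_Suc_alpha a_def[symmetric] by (simp add: algebra_simps)
  finally show ?thesis unfolding a_def .
qed

text \<open>The lower bound at \<open>n\<close> is turned into an upper bound at
  \<open>Suc n\<close> by the splitting \<open>stieltjes_moment_Suc\<close>. This is why
  \<open>alpha n\<close> appears here rather than \<open>alpha (Suc n)\<close>.\<close>

lemma stieltjes_moment_upper:
  assumes "X > 0"
  shows "stieltjes_moment (Suc n) X \<le> legendre_coeff (Suc n) / (1 + alpha n * X)"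
proof -
  have p: "1 + alpha n * X > 0" using alpha_pos[of n] assms by (intro add_pos_nonneg) auto
  have "X * stieltjes_moment (Suc n) X = legendre_coeff n - stieltjes_moment n X"
    using stieltjes_moment_Suc[of X n] assms by simp
  also have "\<dots> \<le> legendre_coeff n - legendre_coeff n / (1 + alpha n * X)"
    using stieltjes_moment_lower[of X n] assms by simp
  also have "\<dots> = X * (legendre_coeff (Suc n) / (1 + alpha n * X))"
    unfolding legendre_coeff_Suc_alpha using p by (simp add: field_simps)
  finally show ?thesis using mult_le_cancel_left_pos[OF assms] by blast
qed

subsection \<open>Expansion and remainder\<close>

lemma continuous_on_stieltjes_moment: "continuous_on {0..} (stieltjes_moment n)"
proof -
  have *: "1 + a * (s * t) > 0" if "a \<ge> 0" "s \<in> {0..1}" "t \<in> {0..1}" for a s t :: real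
    using that by (intro add_pos_nonneg) auto
  have "continuous_on (({0..} \<times> {0..1}) \<times> {0..1})
      (\<lambda>y::(real \<times> real) \<times> real. (snd (fst y) * snd y) ^ n / (1 + fst (fst y) * (snd (fst y) * snd y)))"
    by (intro continuous_intros ballI less_imp_neq[symmetric] *) auto
  hence "continuous_on (({0..} \<times> {0..1}) \<times> {0..1})
      (\<lambda>(y::real \<times> real, t). (snd y * t) ^ n / (1 + fst y * (snd y * t)))"
    by (simp add: case_prod_unfold)
  from continuous_on_arcsine_mean[OF this]
  have "continuous_on ({0..} \<times> {0..1}) (\<lambda>(X::real, s). arcsine_mean (\<lambda>t. (s * t) ^ n / (1 + X * (s * t))))"
    by (simp add: case_prod_unfold)
  from continuous_on_arcsine_mean[OF this] show ?thesis
    unfolding stieltjes_moment_def[abs_def] arcsine_prod_mean_def .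
qed

text \<open>Fubini: \<open>log_kernel (- x * s)\<close> is itself an integral over \<open>u\<close>,
  and averaging over \<open>s\<close> first leaves a Stieltjes moment at
  \<open>x * (1 - u^2)\<close>.\<close>

lemma has_integral_stieltjes_moment:
  assumes "x > 0"
  shows "((\<lambda>u. (- x) ^ n * stieltjes_moment n (x * (1 - u\<^sup>2))) has_integral kernel_moment n x) {0..1}"
proof -
  have pos: "1 + x * s * (1 - u\<^sup>2) > 0" if "s \<in> {0..1}" "u \<in> {0..1}" for s u
    using that assms by (intro add_pos_nonneg mult_nonneg_nonneg) (auto simp: abs_square_le_1)
  have i: "kernel_moment n x = integral {0..1} (\<lambda>u. (- x) ^ n * stieltjes_moment n (x * (1 - u\<^sup>2)))"
  proof -
    have "kernel_moment n x = arcsine_prod_mean (\<lambda>s. integral {0..1} (\<lambda>u. (- x * s) ^ n * (1 / (1 + x * s * (1 - u\<^sup>2)))))"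
      unfolding kernel_moment_def log_kernel_def by (simp only: integral_mult_right) simp
    also have "\<dots> = integral {0..1} (\<lambda>u. arcsine_prod_mean (\<lambda>s. (- x * s) ^ n * (1 / (1 + x * s * (1 - u\<^sup>2)))))"
    proof (rule arcsine_prod_mean_integral_swap)
      have "continuous_on ({0..1} \<times> {0..1}) (\<lambda>y. (- x * fst y) ^ n * (1 / (1 + x * fst y * (1 - (snd y)\<^sup>2))))"
        by (intro continuous_intros ballI less_imp_neq[symmetric] pos) auto
      thus "continuous_on ({0..1} \<times> {0..1}) (\<lambda>(s, u). (- x * s) ^ n * (1 / (1 + x * s * (1 - u\<^sup>2))))"
        by (simp add: case_prod_unfold)
    qed
    also have "\<dots> = integral {0..1} (\<lambda>u. (- x) ^ n * stieltjes_moment n (x * (1 - u\<^sup>2)))"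
      unfolding stieltjes_moment_def arcsine_prod_mean_cmult[symmetric] power_mult_distrib
      by (simp add: mult_ac)
    finally show ?thesis .
  qed
  have "continuous_on {0..1} (\<lambda>u::real. (- x) ^ n * stieltjes_moment n (x * (1 - u\<^sup>2)))"
    by (intro continuous_on_mult continuous_on_const continuous_on_compose2[OF continuous_on_stieltjes_moment])
       (use assms in \<open>auto intro!: continuous_intros simp: abs_square_le_1\<close>)
  thus ?thesis unfolding i by (intro integrable_integral integrable_continuous_real)
qed

definition remainder_integrand :: "nat \<Rightarrow> real \<Rightarrow> real \<Rightarrow> real \<Rightarrow> real" where
  "remainder_integrand N l k u = l / (1 - l\<^sup>2 * u\<^sup>2) * (ell_scale l k * (1 - u\<^sup>2)
      * stieltjes_moment (N + 1) (ell_scale l k * (1 - u\<^sup>2)))"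

lemma continuous_on_remainder_integrand:
  assumes lk: "0 < l" "l < 1" "0 \<le> k" "k < 1"
  shows "continuous_on {0..1} (remainder_integrand N l k)"
  unfolding remainder_integrand_def[abs_def]
  by (intro continuous_intros continuous_on_compose2[OF continuous_on_stieltjes_moment] ballI
        less_imp_neq[symmetric] one_minus_mult_power2_pos lk)
     (use ell_scale_mult_nonneg[OF lk] in auto)

text \<open>Induction on \<open>N\<close>. With \<open>m = 1 - k^2\<close>, a remainder integrand
  \<open>- m ^ N * w * X * J (N + 1)\<close> is rewritten by \<open>wx\<close> as
  \<open>m ^ (N + 1) * (w - l / (1 - l^2)) * J (N + 1)\<close>. The constant weight yields the term
  with \<open>s_fun N\<close>; under \<open>w\<close>, splitting \<open>J (N + 1)\<close> yields a
  logarithmic term and the next remainder.\<close>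

lemma ellF_expansion:
  assumes lk: "0 < l" "l < 1" "0 \<le> k" "k < 1"
  shows "ellF l k = 1/2 * ln ((1 + l) / (1 - l)) * (\<Sum>j\<le>N. legendre_coeff j * (1 - k\<^sup>2) ^ j)
    + 1 / (2 * l) * (\<Sum>n<N. ((1 - l\<^sup>2) / (- (l\<^sup>2))) ^ n * s_fun n (ell_scale l k))
    - (1 - k\<^sup>2) ^ N * integral {0..1} (remainder_integrand N l k)"
proof -
  define x where "x = ell_scale l k"
  define m where "m = 1 - k\<^sup>2"
  define X where "X = (\<lambda>u::real. x * (1 - u\<^sup>2))"
  define w where "w = (\<lambda>u. l / (1 - l\<^sup>2 * u\<^sup>2))"
  define J where "J = (\<lambda>n u. stieltjes_moment n (X u))"
  define \<Lambda> where "\<Lambda> = 1/2 * ln ((1 + l) / (1 - l))"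
  define R where "R = (\<lambda>N. integral {0..1} (remainder_integrand N l k))"
  have x: "x > 0" unfolding x_def by (rule ell_scale_pos[OF lk])
  have m: "m > 0" using lk by (simp add: m_def abs_square_less_1)
  have l2: "0 < l\<^sup>2" "l\<^sup>2 < 1" using lk by (auto simp: abs_square_less_1)
  have X: "X u \<ge> 0" if "u \<in> {0..1}" for u unfolding X_def x_def by (rule ell_scale_mult_nonneg[OF lk that])
  have J: "J n u = legendre_coeff n - X u * J (Suc n) u" if "u \<in> {0..1}" for n u
    unfolding J_def by (rule stieltjes_moment_Suc[OF X[OF that]])
  have r: "remainder_integrand N l k = (\<lambda>u. w u * (X u * J (N + 1) u))" for N
    by (simp add: remainder_integrand_def[abs_def] w_def X_def J_def x_def)
  have R: "(remainder_integrand N l k has_integral R N) {0..1}" for N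
    unfolding R_def by (intro integrable_integral integrable_continuous_real continuous_on_remainder_integrand lk)
  have w: "(w has_integral \<Lambda>) {0..1}"
    unfolding w_def \<Lambda>_def by (rule has_integral_inverse_one_minus_squares[OF lk(1,2)])
  \<comment> \<open>This trades the factor \<open>X\<close> for a change of weight. The constant
    weight \<open>l / (1 - l^2)\<close> is the one under which the Stieltjes moments integrate to
    \<open>kernel_moment\<close>.\<close>
  have wx: "w u - l / (1 - l\<^sup>2) = - (w u * X u / m)" if "u \<in> {0..1}" for u
  proof -
    have A: "1 - l\<^sup>2 * u\<^sup>2 > 0" using one_minus_mult_power2_pos lk that by blast
    have "X u / m = l\<^sup>2 * (1 - u\<^sup>2) / (1 - l\<^sup>2)"
      using m by (simp add: X_def x_def ell_scale_def m_def)
    moreover have "w u - l / (1 - l\<^sup>2) = - (w u * (l\<^sup>2 * (1 - u\<^sup>2) / (1 - l\<^sup>2)))"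
      unfolding w_def using A l2 by (simp add: divide_simps) (simp add: algebra_simps)
    ultimately show ?thesis by (metis times_divide_eq_right)
  qed
  have base: "ellF l k = \<Lambda> - R 0"
  proof -
    have *: "((\<lambda>u. w u - remainder_integrand 0 l k u) has_integral \<Lambda> - R 0) {0..1}"
      by (intro has_integral_diff w R)
    have "ellF l k = integral {0..1} (\<lambda>u. w u * J 0 u)"
      unfolding ellF_eq_integral_prod_mean[OF lk] w_def J_def X_def x_def stieltjes_moment_def by simp
    also have "\<dots> = integral {0..1} (\<lambda>u. w u - remainder_integrand 0 l k u)"
      by (intro integral_cong) (simp add: J[of _ 0] r algebra_simps)
    finally show ?thesis using integral_unique[OF *] by simp
  qed
  have step: "- (m ^ N * R N) = m ^ Suc N * (\<Lambda> * legendre_coeff (Suc N))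
      + 1 / (2 * l) * (((1 - l\<^sup>2) / (- (l\<^sup>2))) ^ N * s_fun N x) - m ^ Suc N * R (Suc N)" for N
  proof -
    let ?p = "((1 - l\<^sup>2) / (- (l\<^sup>2)))"
    \<comment> \<open>This converts the powers of \<open>1 - k^2\<close> in the remainder into the
      powers of \<open>- x\<close> carried by the kernel moments.\<close>
    have mx: "m = - x * ?p" using l2 by (simp add: x_def ell_scale_def m_def)
    have k: "((\<lambda>u. l / (1 - l\<^sup>2) * (m ^ Suc N * J (Suc N) u)) has_integral
        l / (1 - l\<^sup>2) * (?p ^ Suc N * kernel_moment (Suc N) x)) {0..1}"
    proof (rule has_integral_mult_right)
      have "((\<lambda>u. ?p ^ Suc N * ((- x) ^ Suc N * J (Suc N) u)) has_integral ?p ^ Suc N * kernel_moment (Suc N) x) {0..1}"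
        unfolding J_def X_def by (intro has_integral_mult_right has_integral_stieltjes_moment x)
      moreover have "?p ^ Suc N * ((- x) ^ Suc N * c) = m ^ Suc N * c" for c
        unfolding mx power_mult_distrib by (simp only: mult_ac)
      ultimately show "((\<lambda>u. m ^ Suc N * J (Suc N) u) has_integral ?p ^ Suc N * kernel_moment (Suc N) x) {0..1}"
        by (simp only:)
    qed
    have "((\<lambda>u. m ^ Suc N * (w u * legendre_coeff (Suc N)) - l / (1 - l\<^sup>2) * (m ^ Suc N * J (Suc N) u)
        - m ^ Suc N * remainder_integrand (Suc N) l k u) has_integral
        m ^ Suc N * (\<Lambda> * legendre_coeff (Suc N)) - l / (1 - l\<^sup>2) * (?p ^ Suc N * kernel_moment (Suc N) x)
        - m ^ Suc N * R (Suc N)) {0..1}"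
      by (intro has_integral_diff has_integral_mult_right has_integral_mult_left k R w)
    moreover have "((\<lambda>u. - (m ^ N * remainder_integrand N l k u)) has_integral - (m ^ N * R N)) {0..1}"
      by (intro has_integral_neg has_integral_mult_right R)
    hence "((\<lambda>u. m ^ Suc N * (w u * legendre_coeff (Suc N)) - l / (1 - l\<^sup>2) * (m ^ Suc N * J (Suc N) u)
        - m ^ Suc N * remainder_integrand (Suc N) l k u) has_integral - (m ^ N * R N)) {0..1}"
    proof (rule has_integral_eq[rotated])
      fix u :: real assume u: "u \<in> {0..1}"
      have "m ^ Suc N * (w u * legendre_coeff (Suc N)) - l / (1 - l\<^sup>2) * (m ^ Suc N * J (Suc N) u)
        - m ^ Suc N * remainder_integrand (Suc N) l k u
        = m ^ Suc N * (w u * (legendre_coeff (Suc N) - X u * J (Suc (Suc N)) u) - l / (1 - l\<^sup>2) * J (Suc N) u)"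
        unfolding r by (simp add: algebra_simps)
      also have "\<dots> = m ^ Suc N * (J (Suc N) u * (w u - l / (1 - l\<^sup>2)))"
        unfolding J[OF u, symmetric] by (simp add: algebra_simps)
      also have "\<dots> = - (m ^ N * remainder_integrand N l k u)"
        unfolding wx[OF u] r using m by simp
      finally show "- (m ^ N * remainder_integrand N l k u) = m ^ Suc N * (w u * legendre_coeff (Suc N))
        - l / (1 - l\<^sup>2) * (m ^ Suc N * J (Suc N) u) - m ^ Suc N * remainder_integrand (Suc N) l k u" ..
    qed
    ultimately have "- (m ^ N * R N) = m ^ Suc N * (\<Lambda> * legendre_coeff (Suc N))
        - l / (1 - l\<^sup>2) * (?p ^ Suc N * kernel_moment (Suc N) x) - m ^ Suc N * R (Suc N)"
      by (rule has_integral_unique[rotated])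
    \<comment> \<open>One factor \<open>?p\<close> is absorbed by
      \<open>l / (1 - l^2) * ?p = - 1 / l\<close>, lowering the exponent to \<open>N\<close>; the
      moment of index \<open>Suc N\<close> is half of \<open>s_fun N x\<close>, which gives
      \<open>1 / (2 * l)\<close>.\<close>
    moreover have "l / (1 - l\<^sup>2) * (?p ^ Suc N * kernel_moment (Suc N) x) = - (1 / (2 * l) * (?p ^ N * s_fun N x))"
    proof -
      have "l / (1 - l\<^sup>2) * ?p = - (1 / l)" using l2 lk(1) by (simp add: power2_eq_square)
      hence "l / (1 - l\<^sup>2) * (?p ^ Suc N * K) = - (1 / l) * (?p ^ N * K)" for K
        unfolding power_Suc mult.assoc[symmetric] by (simp only:)
      thus ?thesis using s_fun_eq_kernel_moment[OF x, of N] by simp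
    qed
    ultimately show ?thesis by simp
  qed
  have "ellF l k = \<Lambda> * (\<Sum>j\<le>N. legendre_coeff j * m ^ j)
    + 1 / (2 * l) * (\<Sum>n<N. ((1 - l\<^sup>2) / (- (l\<^sup>2))) ^ n * s_fun n x) - m ^ N * R N"
  proof (induction N)
    case (Suc N)
    show ?case unfolding Suc.IH using step[of N]
      by (simp only: sum.atMost_Suc sum.lessThan_Suc distrib_left) (simp add: mult_ac)
  qed (simp add: base)
  thus ?thesis unfolding \<Lambda>_def m_def x_def R_def .
qed

lemma ellF_remainder_eq:
  assumes lk: "0 < l" "l < 1" "0 \<le> k" "k < 1"
  shows "- ellF_remainder N l k = (1 - k\<^sup>2) ^ N * integral {0..1} (remainder_integrand N l k)"
proof -
  have "(\<Sum>j=0..N. pochhammer (1/2) j * pochhammer (1/2) j / (fact j)^2 * (1 - k^2)^j)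
      = (\<Sum>j\<le>N. legendre_coeff j * (1 - k\<^sup>2) ^ j)"
    by (simp add: legendre_coeff_def power2_eq_square atLeast0AtMost)
  thus ?thesis
    unfolding ellF_remainder_def ellF_expansion[OF lk, of N] ell_scale_def by simp
qed

text \<open>The bounds on \<open>stieltjes_moment (N + 1)\<close> are applied pointwise in
  \<open>u\<close>: Jensen at index \<open>N + 1\<close> gives \<open>f_bound (N + 1)\<close>, while
  the upper bound carries \<open>alpha N\<close> and gives \<open>f_bound N\<close>. The
  \<open>1/2\<close> reflects that \<open>f_bound\<close> is twice an integral.\<close>

lemma remainder_integral_bounds:
  assumes lk: "0 < l" "l < 1" "0 \<le> k" "k < 1"
  shows "legendre_coeff (N + 1) / 2 * f_bound (N + 1) l k \<le> integral {0..1} (remainder_integrand N l k)"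
    and "integral {0..1} (remainder_integrand N l k) \<le> legendre_coeff (N + 1) / 2 * f_bound N l k"
proof -
  define c where "c = legendre_coeff (N + 1)"
  have bounds: "c * f_integrand (N + 1) l k u \<le> remainder_integrand N l k u"
      "remainder_integrand N l k u \<le> c * f_integrand N l k u" if u: "u \<in> {0..1}" for u
  proof -
    define X where "X = ell_scale l k * (1 - u\<^sup>2)"
    define w where "w = l / (1 - l\<^sup>2 * u\<^sup>2)"
    have X: "X \<ge> 0" unfolding X_def by (rule ell_scale_mult_nonneg[OF lk u])
    have w: "w \<ge> 0" using one_minus_mult_power2_pos[OF lk(1,2) u] lk(1) by (simp add: w_def)
    have "X * (c / (1 + alpha (N + 1) * X)) \<le> X * stieltjes_moment (N + 1) X"
      unfolding c_def by (intro mult_left_mono stieltjes_moment_lower X)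
    from mult_left_mono[OF this w] show "c * f_integrand (N + 1) l k u \<le> remainder_integrand N l k u"
      unfolding f_integrand_def remainder_integrand_def X_def[symmetric] w_def[symmetric] by (simp add: mult_ac)
    have "X * stieltjes_moment (N + 1) X \<le> X * (c / (1 + alpha N * X))"
    \<comment> \<open>The upper bound was obtained by dividing by \<open>X\<close>, which vanishes
      at the endpoint \<open>u = 1\<close>.\<close>
    proof (cases "X = 0")
      case False
      hence "X > 0" using X by simp
      from stieltjes_moment_upper[OF this, of N] show ?thesis
        using X unfolding c_def by (intro mult_left_mono) simp_all
    qed simp
    from mult_left_mono[OF this w] show "remainder_integrand N l k u \<le> c * f_integrand N l k u"
      unfolding f_integrand_def remainder_integrand_def X_def[symmetric] w_def[symmetric] by (simp add: mult_ac)
  qed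
  have i: "(\<lambda>u. c * f_integrand M l k u) integrable_on {0..1}" "remainder_integrand N l k integrable_on {0..1}" for M
    by (intro integrable_continuous_real continuous_on_mult continuous_on_const continuous_on_f_integrand
        continuous_on_remainder_integrand lk)+
  have f: "integral {0..1} (\<lambda>u. c * f_integrand M l k u) = c / 2 * f_bound M l k" for M
    by (simp add: f_bound_eq lk)
  show "c / 2 * f_bound (N + 1) l k \<le> integral {0..1} (remainder_integrand N l k)"
    unfolding f[symmetric] by (intro integral_le i bounds)
  show "integral {0..1} (remainder_integrand N l k) \<le> c / 2 * f_bound N l k"
    unfolding f[symmetric] by (intro integral_le i bounds)
qed

theorem theorem3:
  fixes l k :: real and N :: nat
  assumes "0 < l" and "l < 1" and "0 \<le> k" and "k < 1" and "N \<ge> 1"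
  shows
    "ellF l k =
       1/2 * ln ((1 + l) / (1 - l)) *
         (\<Sum>j=0..N. pochhammer (1/2) j * pochhammer (1/2) j / (fact j)^2 * (1 - k^2)^j)
       + 1 / (2 * l) *
         (\<Sum>n<N. ((1 - l^2) / (- (l^2)))^n * s_fun n ((1 - k^2) * l^2 / (1 - l^2)))
       + ellF_remainder N l k
     \<and> ellF_remainder N l k < 0
     \<and> (pochhammer (1/2) (N + 1))^2 * (1 - k^2)^N / (2 * (fact (N + 1))^2) * f_bound (N + 1) l k
         \<le> - ellF_remainder N l k
     \<and> - ellF_remainder N l k
         \<le> (pochhammer (1/2) (N + 1))^2 * (1 - k^2)^N / (2 * (fact (N + 1))^2) * f_bound N l k
     \<and> f_bound N l k > 0
     \<and> (\<forall>E :: (real \<times> real) set.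
          E \<subseteq> {0<..<1} \<times> {0..<1} \<and> bdd_above ((\<lambda>(l', k'). (1 - k') / (1 - l')) ` E)
          \<longrightarrow> bounded ((\<lambda>(l', k'). f_bound N l' k') ` E))
     \<and> strict_antimono_on {1..} (\<lambda>M. f_bound M l k)"
proof -
  note lk = assms(1-4)
  define I where "I = integral {0..1} (remainder_integrand N l k)"
  define c where "c = legendre_coeff (N + 1) / 2"
  have m: "(1 - k\<^sup>2) ^ N > 0" using lk by (simp add: abs_square_less_1)
  have coeff: "(pochhammer (1/2) (N + 1))^2 * (1 - k^2)^N / (2 * (fact (N + 1))^2) * t = (1 - k\<^sup>2) ^ N * (c * t)" for t
    by (simp add: c_def legendre_coeff_def power_divide mult_ac del: fact_Suc)
  have I: "c * f_bound (N + 1) l k \<le> I" "I \<le> c * f_bound N l k"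
    unfolding c_def I_def by (rule remainder_integral_bounds[OF lk])+
  have "c * f_bound (N + 1) l k > 0"
    using f_bound_pos[OF lk, of "N + 1"] legendre_coeff_pos[of "N + 1"] by (simp add: c_def)
  hence "(1 - k\<^sup>2) ^ N * I > 0" using I(1) m by (intro mult_pos_pos) auto
  hence neg: "ellF_remainder N l k < 0"
    using ellF_remainder_eq[OF lk, of N] by (simp add: I_def)
  have bdd: "bounded ((\<lambda>(l', k'). f_bound N l' k') ` E)"
    if E: "E \<subseteq> {0<..<1} \<times> {0..<1}" and bdd: "bdd_above ((\<lambda>(l', k'). (1 - k') / (1 - l')) ` E)"
    for E :: "(real \<times> real) set"
  proof -
    from bdd obtain C where C: "\<And>l' k'. (l', k') \<in> E \<Longrightarrow> (1 - k') / (1 - l') \<le> C"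
      unfolding bdd_above_def by force
    \<comment> \<open>Positivity turns the one-sided estimate \<open>f_bound_le\<close> into a bound
      on the norm.\<close>
    have "norm (f_bound N l' k') \<le> 4 * C" if "(l', k') \<in> E" for l' k'
    proof -
      have lk': "0 < l'" "l' < 1" "0 \<le> k'" "k' < 1" using E that by auto
      show ?thesis
        using f_bound_pos[OF lk', of N] f_bound_le[OF lk', of N] C[OF that]
        unfolding real_norm_def by linarith
    qed
    thus ?thesis by (intro boundedI) auto
  qed
  have "strict_antimono_on {1..} (\<lambda>M. f_bound M l k)"
    by (auto simp: monotone_on_def intro!: f_bound_strict_antimono lk)
  moreover have "(1 - k\<^sup>2) ^ N * (c * f_bound (N + 1) l k) \<le> - ellF_remainder N l k"
    "- ellF_remainder N l k \<le> (1 - k\<^sup>2) ^ N * (c * f_bound N l k)"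
    unfolding ellF_remainder_eq[OF lk] I_def[symmetric] using m I by (simp_all add: mult_left_mono)
  ultimately show ?thesis
    unfolding coeff using neg bdd f_bound_pos[OF lk, of N] by (auto simp: ellF_remainder_def)
qed

end
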